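(* Let $|\beta|\le\tfrac12$ and let $U_\beta,V_\beta,W_\beta$ be the normalized Struve functions. Let $\phi$ be a Ma-Minda function, let $\alpha$ be the radius of the largest open disk $\{w:|w-1|<\alpha\}$ contained in $\phi(\mathbb D)$, and suppose $\phi(-1)=1-\alpha$. Then the $\mathcal C(\phi)$-radii of $U_\beta$, $V_\beta$ and $W_\beta$ are, respectively, the smallest positive roots of the following equations in $r$: (i) $rU''_\beta(r)+\alpha U'_\beta(r)=0$; (ii) $rV''_\beta(r)+\alpha V'_\beta(r)=0$; (iii) $rW''_\beta(r)+\alpha W'_\beta(r)=0$.
   Context: Struve function: $\mathbf H_\beta(z)=\frac{(z/2)^{\beta+1}}{\sqrt{\pi/4}\,\Gamma(\beta+\frac32)}\,{}_1F_2\left(1;\frac32,\beta+\frac32;-\frac{z^2}4\right)$. Normalized functions: $U_\beta(z)=\left(\sqrt\pi\,2^\beta\Gamma(\beta+\frac32)\mathbf H_\beta(z)\right)^{1/(\beta+1)}$, i.e. $z\left({}_1F_2(1;\frac32,\beta+\frac32;-\frac{z^2}4)\right)^{1/(\beta+1)}$ with the branch of the power equal to $1$ at $0$; $V_\beta(z)=\sqrt\pi\,2^\beta z^{-\beta}\Gamma(\beta+\frac32)\mathbf H_\beta(z)$; $W_\beta(z)=\sqrt\pi\,2^\beta z^{(1-\beta)/2}\Gamma(\beta+\frac32)\mathbf H_\beta(\sqrt z)$. (So $V_\beta(z)=z\,{}_1F_2(1;\frac32,\beta+\frac32;-\frac{z^2}4)$ and $W_\beta(z)=z\,{}_1F_2(1;\frac32,\beta+\frac32;-\frac{z}4)$.)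 $\mathbb D$ is the open unit disk, $\mathcal A$ the analytic functions $f$ on $\mathbb D$ with $f(0)=0$, $f'(0)=1$. A Ma-Minda function is an analytic univalent $\phi$ on $\mathbb D$ with $\Re\phi>0$, $\phi(0)=1$, $\phi'(0)>0$, and $\phi(\mathbb D)$ starlike with respect to $1$ and symmetric about the real axis; $\phi(-1)$ means $\lim_{x\to-1^+}\phi(x)$. $\mathcal C(\phi)=\{f\in\mathcal A: 1+zf''(z)/f'(z)\prec\phi(z)\}$, where $\prec$ is subordination; since $\phi$ is univalent this means $1+zf''(z)/f'(z)\in\phi(\mathbb D)$ on $\mathbb D$. Radius: for $f$ analytic near $0$ with $f(0)=0$, $f'(0)=1$, the $\mathcal C(\phi)$-radius of $f$ is the largest $r_0>0$ (not required to be $\le1$) such that $f$ is analytic with $f'\ne0$ in $|z|<r_0$, and $1+zf''(z)/f'(z)\in\phi(\mathbb D)$ for all $|z|<r_0$. *)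

theory Defs
  imports "HOL-Complex_Analysis.Complex_Analysis"
begin

(* 1F2(a; b, c; z) *)
definition hypergeo_1F2 :: "complex \<Rightarrow> complex \<Rightarrow> complex \<Rightarrow> complex \<Rightarrow> complex" where
  "hypergeo_1F2 a b c z = eval_fps (fps_hypergeo [a] [b, c] 1) z"

(* Non-integer powers of complex numbers are principal values (powr), and 0 powr a = 0. *)
definition struve_H :: "real \<Rightarrow> complex \<Rightarrow> complex" where
  "struve_H \<beta> z =
     (z / 2) powr of_real (\<beta> + 1) / of_real (sqrt (pi / 4) * Gamma (\<beta> + 3/2))
       * hypergeo_1F2 1 (3/2) (of_real (\<beta> + 3/2)) (- (z\<^sup>2 / 4))"

(* On the positive real axis, up to the first positive zero of the Struve function, this is
   (sqrt pi * 2^beta * Gamma(beta + 3/2) * H_beta(z)) ^ (1 / (beta + 1)); see struve_U_of_real.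
   The principal power of 1F2 is the branch with value 1 at 0, and it is analytic near 0.
   Farther from 0 it may jump where 1F2 is a negative real; class_C_radius is therefore
   stated for the germ at 0. *)
definition struve_U :: "real \<Rightarrow> complex \<Rightarrow> complex" where
  "struve_U \<beta> z =
     z * hypergeo_1F2 1 (3/2) (of_real (\<beta> + 3/2)) (- (z\<^sup>2 / 4)) powr of_real (1 / (\<beta> + 1))"

(* The principal branches in the next two definitions combine correctly on the whole plane:
   struve_V_eq and struve_W_eq. *)
definition struve_V :: "real \<Rightarrow> complex \<Rightarrow> complex" where
  "struve_V \<beta> z =
     of_real (sqrt pi * 2 powr \<beta>) * z powr of_real (- \<beta>)
       * of_real (Gamma (\<beta> + 3/2)) * struve_H \<beta> z"

definition struve_W :: "real \<Rightarrow> complex \<Rightarrow> complex" where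
  "struve_W \<beta> z =
     of_real (sqrt pi * 2 powr \<beta>) * z powr of_real ((1 - \<beta>) / 2)
       * of_real (Gamma (\<beta> + 3/2)) * struve_H \<beta> (csqrt z)"

definition ma_minda :: "(complex \<Rightarrow> complex) \<Rightarrow> bool" where
  "ma_minda \<phi> \<longleftrightarrow>
     \<phi> holomorphic_on ball 0 1 \<and> inj_on \<phi> (ball 0 1) \<and>
     (\<forall>z\<in>ball 0 1. 0 < Re (\<phi> z)) \<and>
     \<phi> 0 = 1 \<and> deriv \<phi> 0 \<in> \<real> \<and> 0 < Re (deriv \<phi> 0) \<and>
     (\<forall>w\<in>\<phi> ` ball 0 1. closed_segment 1 w \<subseteq> \<phi> ` ball 0 1) \<and>
     cnj ` \<phi> ` ball 0 1 = \<phi> ` ball 0 1"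

definition largest_disk_radius :: "complex set \<Rightarrow> complex \<Rightarrow> real \<Rightarrow> bool" where
  "largest_disk_radius S c \<alpha> \<longleftrightarrow>
     0 < \<alpha> \<and> ball c \<alpha> \<subseteq> S \<and> (\<forall>s. ball c s \<subseteq> S \<longrightarrow> s \<le> \<alpha>)"

(* g is the analytic continuation to the disk |z| < r of the germ of f at 0. *)
definition class_C_on_disk :: "(complex \<Rightarrow> complex) \<Rightarrow> (complex \<Rightarrow> complex) \<Rightarrow> real \<Rightarrow> bool" where
  "class_C_on_disk \<phi> f r \<longleftrightarrow>
     (\<exists>g. g holomorphic_on ball 0 r \<and> (\<forall>\<^sub>F z in nhds 0. g z = f z) \<and>
        (\<forall>z\<in>ball 0 r. deriv g z \<noteq> 0 \<and>
           1 + z * deriv (deriv g) z / deriv g z \<in> \<phi> ` ball 0 1))"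

definition class_C_radius :: "(complex \<Rightarrow> complex) \<Rightarrow> (complex \<Rightarrow> complex) \<Rightarrow> real \<Rightarrow> bool" where
  "class_C_radius \<phi> f r0 \<longleftrightarrow>
     0 < r0 \<and> class_C_on_disk \<phi> f r0 \<and> (\<forall>r>0. class_C_on_disk \<phi> f r \<longrightarrow> r \<le> r0)"

definition smallest_positive_root :: "(complex \<Rightarrow> complex) \<Rightarrow> real \<Rightarrow> bool" where
  "smallest_positive_root E r \<longleftrightarrow>
     0 < r \<and> E (of_real r) = 0 \<and> (\<forall>s. 0 < s \<and> s < r \<longrightarrow> E (of_real s) \<noteq> 0)"

lemma struve_H_normalized:
  assumes "\<beta> > - 3/2"
  shows "of_real (sqrt pi * 2 powr \<beta>) * of_real (Gamma (\<beta> + 3/2)) * struve_H \<beta> z =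
    z powr of_real (\<beta> + 1) * hypergeo_1F2 1 (3/2) (of_real (\<beta> + 3/2)) (- (z\<^sup>2 / 4))"
proof -
  have G: "Gamma (\<beta> + 3/2) \<noteq> 0"
    using Gamma_real_pos[of "\<beta> + 3/2"] assms by linarith
  have P: "(z / 2) powr of_real (\<beta> + 1) = z powr of_real (\<beta> + 1) / of_real (2 powr (\<beta> + 1))"
  proof (cases "z = 0")
    case False
    then have "Ln (z / 2) = Ln z - of_real (ln 2)"
      using Ln_divide_of_real[of 2 z] by simp
    moreover have "of_real (2 powr (\<beta> + 1)) = exp (of_real (\<beta> + 1) * of_real (ln 2) :: complex)"
      by (simp add: powr_def exp_of_real del: of_real_add flip: of_real_mult)
    ultimately show ?thesis
      using False by (simp only: powr_def right_diff_distrib exp_diff) simp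
  qed auto
  have "sqrt pi * 2 powr \<beta> = 2 powr (\<beta> + 1) * sqrt (pi / 4)"
    by (simp add: real_sqrt_divide powr_add)
  then show ?thesis
    unfolding struve_H_def P using G by simp
qed

lemma struve_V_eq:
  assumes "\<beta> > - 3/2"
  shows "struve_V \<beta> z = z * hypergeo_1F2 1 (3/2) (of_real (\<beta> + 3/2)) (- (z\<^sup>2 / 4))"
proof -
  have "struve_V \<beta> z = z powr of_real (- \<beta>) *
      (of_real (sqrt pi * 2 powr \<beta>) * of_real (Gamma (\<beta> + 3/2)) * struve_H \<beta> z)"
    unfolding struve_V_def by (simp add: ac_simps)
  also have "\<dots> = (z powr of_real (- \<beta>) * z powr of_real (\<beta> + 1)) *
      hypergeo_1F2 1 (3/2) (of_real (\<beta> + 3/2)) (- (z\<^sup>2 / 4))"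
    by (subst struve_H_normalized[OF assms]) (simp only: mult.assoc)
  also have "z powr of_real (- \<beta>) * z powr of_real (\<beta> + 1) = z"
    by (cases "z = 0") (simp_all flip: powr_add)
  finally show ?thesis .
qed

lemma struve_W_eq:
  assumes "\<beta> > - 3/2"
  shows "struve_W \<beta> z = z * hypergeo_1F2 1 (3/2) (of_real (\<beta> + 3/2)) (- (z / 4))"
proof -
  have "struve_W \<beta> z = z powr of_real ((1 - \<beta>) / 2) *
      (of_real (sqrt pi * 2 powr \<beta>) * of_real (Gamma (\<beta> + 3/2)) * struve_H \<beta> (csqrt z))"
    unfolding struve_W_def by (simp add: ac_simps)
  also have "\<dots> = (z powr of_real ((1 - \<beta>) / 2) * csqrt z powr of_real (\<beta> + 1)) *
      hypergeo_1F2 1 (3/2) (of_real (\<beta> + 3/2)) (- (z / 4))"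
    by (subst struve_H_normalized[OF assms]) (simp add: mult.assoc)
  also have "z powr of_real ((1 - \<beta>) / 2) * csqrt z powr of_real (\<beta> + 1) = z"
  proof (cases "z = 0")
    case False
    have "Ln (csqrt z) = Ln z / 2"
    proof (rule Ln_unique)
      show "exp (Ln z / 2) = csqrt z" using False by (simp add: csqrt_exp_Ln)
      show "- pi < Im (Ln z / 2)" "Im (Ln z / 2) \<le> pi"
        using mpi_less_Im_Ln[OF False] Im_Ln_le_pi[OF False] pi_gt_zero by simp_all
    qed
    then have "z powr of_real ((1 - \<beta>) / 2) * csqrt z powr of_real (\<beta> + 1) =
        exp (of_real ((1 - \<beta>) / 2) * Ln z + of_real (\<beta> + 1) * (Ln z / 2))"
      using False unfolding exp_add by (simp add: powr_def \<open>Ln (csqrt z) = Ln z / 2\<close> del: of_real_add)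
    also have "of_real ((1 - \<beta>) / 2) * Ln z + of_real (\<beta> + 1) * (Ln z / 2) = Ln z"
      by (simp add: field_simps)
    finally show ?thesis using False by simp
  qed auto
  finally show ?thesis .
qed

lemma struve_U_of_real:
  assumes "\<beta> > - 1" "x > 0"
    and F: "hypergeo_1F2 1 (3/2) (of_real (\<beta> + 3/2)) (- ((of_real x)\<^sup>2 / 4)) = of_real y" "y > 0"
  shows "struve_U \<beta> (of_real x) =
    (of_real (sqrt pi * 2 powr \<beta>) * of_real (Gamma (\<beta> + 3/2)) * struve_H \<beta> (of_real x))
      powr of_real (1 / (\<beta> + 1))"
proof -
  have "(x powr (\<beta> + 1) * y) powr (1 / (\<beta> + 1)) = x * y powr (1 / (\<beta> + 1))"
    using assms by (simp add: powr_mult powr_powr)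
  moreover have "of_real (sqrt pi * 2 powr \<beta>) * of_real (Gamma (\<beta> + 3/2)) * struve_H \<beta> (of_real x) =
      complex_of_real (x powr (\<beta> + 1) * y)"
    using assms struve_H_normalized[of \<beta> "of_real x"] by (simp add: powr_of_real flip: of_real_add)
  moreover have "struve_U \<beta> (of_real x) = of_real (x * y powr (1 / (\<beta> + 1)))"
    unfolding struve_U_def F(1) using assms(4) by (simp add: powr_of_real del: of_real_divide)
  ultimately show ?thesis
    using assms(2,4) by (simp add: powr_of_real del: of_real_divide of_real_mult)
qed

end

theory Submission
  imports Defs "HOL-Computational_Algebra.Fundamental_Theorem_Algebra"
begin

text \<open>
  Write \<open>G(w) = \<^sub>1F\<^sub>2(1; 3/2, \<beta> + 3/2; -w/4)\<close>. The point is that \<open>- log G\<close> has nonnegative Taylor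
  coefficients. Up to a constant, \<open>G(z\<^sup>2)\<close> is \<open>(1/z) \<integral>\<^sub>0\<^sup>1 (1 - t\<^sup>2)\<^bsup>\<beta>-1/2\<^esup> sin(zt) dt\<close> if \<open>\<beta> > -1/2\<close>, with a nondecreasing
  weight as \<open>\<beta> \<le> 1/2\<close>. Following Polya, its Riemann sums are sine polynomials with nondecreasing
  coefficients, which have only real zeros by the Enestrom-Kakeya theorem. They factor
  accordingly, and for each factor the logarithmic derivative is a cotangent, whose Riccati
  equation yields the signs of the Taylor coefficients. These survive the coefficientwise limit,
  also as \<open>\<beta>\<close> tends to \<open>-1/2\<close>. No Hadamard factorization is needed.

  Each of the three functions is \<open>f(z) = z exp(- \<Lambda>(z))\<close> with nonnegative Taylor coefficients of
  \<open>\<Lambda>\<close>. With \<open>T = z\<Lambda>'\<close> one gets \<open>- zf''/f' = Q = T + zT'/(1 - T)\<close>, so \<open>|Q(z)| \<le> Q(|z|)\<close>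
  as long as \<open>T(|z|) < 1\<close>, and \<open>Q\<close> increases on the positive axis through every value up to \<open>1\<close>.
  The radius is the point where \<open>Q = \<alpha>\<close>; there \<open>1 + zf''/f' = 1 - \<alpha>\<close>, which is not
  in the image of \<open>\<phi>\<close>.
\<close>

subsection \<open>Zeros of sine polynomials\<close>

text \<open>Horner recursion: the quantity D n inside the norm satisfies D (n+1) = w (a (n+1) - a n
  + D n), so the bound propagates because the increments of \<open>a\<close> are
  nonnegative.\<close>

lemma enestrom_kakeya_estimate:
  fixes a :: "nat \<Rightarrow> real" and w :: complex
  assumes "0 \<le> a 0" "\<And>k. k < n \<Longrightarrow> a k \<le> a (Suc k)" "norm w \<le> 1"
  shows "norm (of_real (a n) - (1 - w) * (\<Sum>k\<le>n. of_real (a k) * w ^ (n - k))) \<le> a n * norm w"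
  using assms(2)
proof (induction n)
  case 0
  then show ?case using assms by (simp add: algebra_simps norm_mult)
next
  case (Suc n)
  define S where "S = (\<Sum>k\<le>n. of_real (a k) * w ^ (n - k))"
  have IH: "norm (of_real (a n) - (1 - w) * S) \<le> a n * norm w"
    unfolding S_def using Suc by simp
  have "0 \<le> a k" if "k \<le> n" for k
    using that Suc.prems assms(1) by (induction k) (auto intro: order.trans)
  then have nn: "0 \<le> a n" by simp
  have "(\<Sum>k\<le>Suc n. of_real (a k) * w ^ (Suc n - k)) = w * S + of_real (a (Suc n))"
    unfolding S_def by (simp add: sum_distrib_left Suc_diff_le mult_ac)
  then have "of_real (a (Suc n)) - (1 - w) * (\<Sum>k\<le>Suc n. of_real (a k) * w ^ (Suc n - k)) =
      w * (of_real (a (Suc n) - a n) + (of_real (a n) - (1 - w) * S))"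
    by (simp add: algebra_simps)
  also have "norm \<dots> \<le> norm w * ((a (Suc n) - a n) + a n * norm w)"
    unfolding norm_mult using Suc.prems[of n] IH
    by (intro mult_left_mono norm_triangle_le add_mono) (auto simp flip: of_real_diff)
  also have "\<dots> \<le> norm w * ((a (Suc n) - a n) + a n)"
    using nn assms(3) by (intro mult_left_mono add_left_mono) (auto simp: mult_left_le)
  finally show ?case by (simp add: mult.commute)
qed

text \<open>A vanishing sum would turn the estimate into \<open>a n \<le> a n * norm w\<close>,
  which is impossible for \<open>norm w < 1\<close>.\<close>

lemma enestrom_kakeya:
  fixes a :: "nat \<Rightarrow> real" and w :: complex
  assumes "0 < a 0" "\<And>k. k < n \<Longrightarrow> a k \<le> a (Suc k)" "norm w < 1"
  shows "(\<Sum>k\<le>n. of_real (a k) * w ^ (n - k)) \<noteq> 0"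
proof
  assume "(\<Sum>k\<le>n. of_real (a k) * w ^ (n - k)) = 0"
  with enestrom_kakeya_estimate[of a n w] assms have "\<bar>a n\<bar> \<le> a n * norm w" by simp
  moreover have "0 < a n"
    using assms(1,2) by (induction n) (auto intro: less_le_trans)
  ultimately show False using assms(3)
    by (simp add: mult_le_cancel_left1)
qed

text \<open>The Blaschke factor bound without a quotient: the difference of the squared norms
  factors into two nonnegative terms.\<close>

lemma norm_diff_le_norm_one_minus_mult_cnj:
  fixes r w :: complex
  assumes "norm r \<le> 1" "norm w \<le> 1"
  shows "norm (w - r) \<le> norm (1 - r * cnj w)"
proof -
  have "(norm (1 - r * cnj w))\<^sup>2 - (norm (w - r))\<^sup>2 = (1 - (norm r)\<^sup>2) * (1 - (norm w)\<^sup>2)"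
  proof -
    have "complex_of_real ((norm (1 - r * cnj w))\<^sup>2 - (norm (w - r))\<^sup>2) =
        complex_of_real ((1 - (norm r)\<^sup>2) * (1 - (norm w)\<^sup>2))"
      by (simp only: of_real_diff of_real_mult of_real_1 complex_norm_square) (simp add: algebra_simps)
    then show ?thesis by (simp only: of_real_eq_iff)
  qed
  also have "\<dots> \<ge> 0" using assms by (simp add: power_le_one)
  finally have "(norm (w - r))\<^sup>2 \<le> (norm (1 - r * cnj w))\<^sup>2" by simp
  then show ?thesis by (rule power2_le_imp_le) simp
qed

text \<open>Reflection turns each linear factor z - r into 1 - r z, so the Blaschke bound can be
  multiplied over all roots.\<close>

lemma norm_poly_le_norm_reflect_poly:
  fixes p :: "complex poly"
  assumes "\<And>r. poly p r = 0 \<Longrightarrow> norm r \<le> 1" "norm w \<le> 1"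
  shows "norm (poly p w) \<le> norm (poly (reflect_poly p) (cnj w))"
proof (cases "p = 0")
  case False
  have *: "norm (poly (\<Prod>x\<in>#A. [:-x, 1:]) w) \<le> norm (poly (reflect_poly (\<Prod>x\<in>#A. [:-x, 1:])) (cnj w))"
    if "\<And>r. r \<in># A \<Longrightarrow> norm r \<le> 1" for A
    using that
  proof (induction A)
    case (add r A)
    have "reflect_poly [:-r, 1:] = [:1, -r:]"
      by (cases "r = 0") (auto simp: reflect_poly_def)
    moreover have "norm (w - r) \<le> norm (1 - r * cnj w)"
      using add.prems assms(2) by (intro norm_diff_le_norm_one_minus_mult_cnj) auto
    ultimately show ?case using add
      by (auto simp: reflect_poly_mult norm_mult mult.commute simp del: mult_pCons_left
        intro!: mult_mono)
  qed auto
  obtain A where A: "p = smult (lead_coeff p) (\<Prod>x\<in>#A. [:-x, 1:])"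
    using alg_closed_imp_factorization[of p] False by blast
  have "norm r \<le> 1" if "r \<in># A" for r
  proof (rule assms(1))
    have "poly (\<Prod>x\<in>#A. [:-x, 1:]) r = 0"
      using that by (auto simp: poly_prod_mset prod_mset_zero_iff)
    then show "poly p r = 0" by (subst A) simp
  qed
  from *[OF this] show ?thesis
    by (subst (1 2) A) (simp add: reflect_poly_smult norm_mult mult_left_mono)
qed simp

text \<open>Up to the unit \<open>2\<i>w\<^sup>n\<close>, this polynomial at \<open>w = e\<^bsup>ix\<^esup>\<close> is the sine polynomial with
  coefficients \<open>a\<close>.\<close>

definition sine_poly :: "(nat \<Rightarrow> real) \<Rightarrow> nat \<Rightarrow> complex poly" where
  "sine_poly a n = (\<Sum>k\<le>n. monom (of_real (a k)) (n + k) - monom (of_real (a k)) (n - k))"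

lemma poly_sine_poly:
  "poly (sine_poly a n) w = (\<Sum>k\<le>n. of_real (a k) * (w ^ (n + k) - w ^ (n - k)))"
  by (simp add: sine_poly_def poly_sum poly_monom algebra_simps)

context
  fixes a :: "nat \<Rightarrow> real" and n :: nat
  assumes pos: "0 < a 0" and mono: "\<And>k. k < n \<Longrightarrow> a k \<le> a (Suc k)" and n: "0 < n"
begin

lemma coeff_pos: "k \<le> n \<Longrightarrow> 0 < a k"
  using pos mono by (induction k) (auto intro: less_le_trans)

text \<open>Enestrom-Kakeya at the inverse of a root puts all roots of the left polynomial in the
  closed disk, so it is dominated by its reflection. Since the coefficients are real, the conjugate
  argument does not change the norm.\<close>

lemma norm_sum_le_norm_reflected_sum:
  fixes w :: complex
  assumes "norm w < 1"
  shows "norm (\<Sum>k\<le>n. of_real (a k) * w ^ k) \<le> norm (\<Sum>k\<le>n. of_real (a k) * w ^ (n - k))"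
proof -
  define p :: "complex poly" where "p = (\<Sum>k\<le>n. monom (of_real (a k)) k)"
  have coeff: "coeff p k = (if k \<le> n then of_real (a k) else 0)" for k
    by (auto simp: p_def coeff_sum)
  have deg: "degree p = n"
    using coeff_pos[of n] by (intro antisym le_degree degree_le) (auto simp: coeff)
  have reflect: "poly (reflect_poly p) v = (\<Sum>k\<le>n. of_real (a k) * v ^ (n - k))" for v
  proof -
    have "reflect_poly p = (\<Sum>k\<le>n. monom (of_real (a k)) (n - k))"
    proof (rule poly_eqI)
      fix m
      have "(\<Sum>k\<le>n. coeff (monom (of_real (a k)) (n - k)) m) =
          (\<Sum>k\<le>n. if k = n - m \<and> m \<le> n then of_real (a k) else (0::complex))"
        by (intro sum.cong) auto
      then show "coeff (reflect_poly p) m = coeff (\<Sum>k\<le>n. monom (of_real (a k)) (n - k)) m"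
        by (auto simp: coeff_reflect_poly deg coeff coeff_sum)
    qed
    then show ?thesis by (simp add: poly_sum poly_monom)
  qed
  have "norm r \<le> 1" if "poly p r = 0" for r
  proof (rule ccontr)
    assume r: "\<not> norm r \<le> 1"
    then have "poly (reflect_poly p) (inverse r) = 0"
      using that by (subst poly_reflect_poly_nz) auto
    moreover have "norm (inverse r) < 1" using r by (simp add: norm_inverse inverse_less_1_iff)
    ultimately show False
      using enestrom_kakeya[of a n "inverse r"] pos mono by (simp add: reflect)
  qed
  then have "norm (poly p w) \<le> norm (poly (reflect_poly p) (cnj w))"
    using assms by (intro norm_poly_le_norm_reflect_poly) auto
  also have "poly (reflect_poly p) (cnj w) = cnj (\<Sum>k\<le>n. of_real (a k) * w ^ (n - k))"
    by (simp add: reflect)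
  finally show ?thesis by (simp only: complex_mod_cnj) (simp add: p_def poly_sum poly_monom)
qed

text \<open>At a zero, \<open>R = w ^ n * P\<close> while \<open>norm P \<le> norm R\<close>. As
  \<open>norm w ^ n < 1\<close>, this forces \<open>R = 0\<close>, contradicting
  Enestrom-Kakeya.\<close>

lemma sine_poly_nonzero_in_disk:
  assumes "norm w < 1"
  shows "poly (sine_poly a n) w \<noteq> 0"
proof
  define P where "P = (\<Sum>k\<le>n. of_real (a k) * w ^ k)"
  define R where "R = (\<Sum>k\<le>n. of_real (a k) * w ^ (n - k))"
  assume "poly (sine_poly a n) w = 0"
  then have "R = w ^ n * P"
    by (simp add: poly_sine_poly P_def R_def sum_distrib_left right_diff_distrib sum_subtractf
      power_add mult_ac)
  then have "norm R = norm w ^ n * norm P" by (simp add: norm_mult norm_power)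
  also have "\<dots> \<le> norm w ^ n * norm R"
    unfolding P_def R_def using norm_sum_le_norm_reflected_sum[OF assms] by (simp add: mult_left_mono)
  finally have "norm R * (1 - norm w ^ n) \<le> 0" by (simp add: algebra_simps)
  moreover have "norm w ^ n < 1" using assms n by (simp add: power_less_one_iff)
  moreover have "R \<noteq> 0" unfolding R_def using enestrom_kakeya[of a n w] pos mono assms by simp
  ultimately show False by (simp add: mult_le_0_iff)
qed

text \<open>Up to sign the polynomial is self-reciprocal, so a root outside the circle would give
  one inside.\<close>

lemma sine_poly_root_on_circle:
  assumes "poly (sine_poly a n) w = 0"
  shows "norm w = 1"
proof -
  have "\<not> norm w < 1" using sine_poly_nonzero_in_disk assms by blast
  moreover have "\<not> norm w > 1"
  proof
    assume w: "norm w > 1"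
    then have [simp]: "w \<noteq> 0" by auto
    have "w ^ (2 * n) * (inverse w ^ (n + k) - inverse w ^ (n - k)) = w ^ (n - k) - w ^ (n + k)"
      if "k \<le> n" for k
    proof -
      have "w ^ (2 * n) = w ^ (n + k) * w ^ (n - k)" "w ^ (2 * n) = w ^ (n - k) * w ^ (n + k)"
        using that by (simp_all add: mult_2 flip: power_add)
      then show ?thesis unfolding right_diff_distrib by (simp add: power_inverse field_simps)
    qed
    then have "w ^ (2 * n) * poly (sine_poly a n) (inverse w) = - poly (sine_poly a n) w"
      unfolding poly_sine_poly sum_distrib_left
      by (simp add: mult.left_commute flip: sum_negf) (simp add: right_diff_distrib)
    then have "poly (sine_poly a n) (inverse w) = 0" using assms by simp
    moreover have "norm (inverse w) < 1" using w by (simp add: norm_inverse inverse_less_1_iff)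
    ultimately show False using sine_poly_nonzero_in_disk by blast
  qed
  ultimately show ?thesis by linarith
qed

text \<open>The root 1 is split off because it will cancel the zero of the sine polynomial at the
  origin. It is simple, since the derivative there is the positive sum of
  \<open>2 * k * a k\<close>, hence the remaining roots differ from 1.\<close>

lemma sine_poly_factorization:
  obtains A c where "c \<noteq> 0" "\<And>r. r \<in># A \<Longrightarrow> norm r = 1 \<and> r \<noteq> 1"
    "sine_poly a n = smult c ([:-1, 1:] * (\<Prod>r\<in>#A. [:-r, 1:]))"
proof -
  have "poly (sine_poly a n) 1 = 0" by (simp add: poly_sine_poly)
  then obtain q where q: "sine_poly a n = [:-1, 1:] * q"
    using poly_eq_0_iff_dvd by (metis dvdE)
  have "poly q 1 = poly (pderiv (sine_poly a n)) 1"
    unfolding q pderiv_mult by (simp add: pderiv_pCons)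
  also have "\<dots> = (\<Sum>k\<le>n. of_real (a k * (2 * real k)))"
    unfolding sine_poly_def higher_pderiv_sum[of 1, simplified] pderiv_diff pderiv_monom poly_sum poly_diff poly_monom
    by (intro sum.cong refl) (simp add: of_nat_diff flip: right_diff_distrib left_diff_distrib)
  also have "\<dots> = of_real (\<Sum>k\<le>n. a k * (2 * real k))" by simp
  also have "\<dots> \<noteq> 0"
  proof -
    have "0 < (\<Sum>k\<le>n. a k * (2 * real k))"
      using n coeff_pos by (intro sum_pos2[of _ n]) (auto simp: less_imp_le)
    then show ?thesis by (metis of_real_eq_0_iff less_irrefl)
  qed
  finally have q1: "poly q 1 \<noteq> 0" .
  then have "q \<noteq> 0" by auto
  then obtain A where A: "q = smult (lead_coeff q) (\<Prod>r\<in>#A. [:-r, 1:])"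
    using alg_closed_imp_factorization by blast
  show thesis
  proof (rule that)
    fix r assume "r \<in># A"
    then have "poly (\<Prod>r\<in>#A. [:-r, 1:]) r = 0"
      by (auto simp: poly_prod_mset prod_mset_zero_iff)
    then have "poly q r = 0" by (subst A) simp
    then show "norm r = 1 \<and> r \<noteq> 1"
      using q1 sine_poly_root_on_circle[of r] by (auto simp: q)
  next
    show "sine_poly a n = smult (lead_coeff q) ([:-1, 1:] * (\<Prod>r\<in>#A. [:-r, 1:]))"
      unfolding q by (subst A) simp
  qed (use \<open>q \<noteq> 0\<close> in simp)
qed

end

subsection \<open>Signs of the Taylor coefficients of logarithmic derivatives\<close>

unbundle no vec_syntax

text \<open>The derivative of - log A as a formal series; it has this meaning when
  \<open>A $ 0\<close> is nonzero.\<close>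

definition neg_logderiv :: "complex fps \<Rightarrow> complex fps" where
  "neg_logderiv A = - fps_deriv A * inverse A"

lemma neg_logderiv_times_self: "A $ 0 \<noteq> 0 \<Longrightarrow> neg_logderiv A * A = - fps_deriv A"
  by (simp add: neg_logderiv_def inverse_mult_eq_1 mult.assoc)

lemma neg_logderiv_unique:
  assumes "A $ 0 \<noteq> 0" "D * A = - fps_deriv A"
  shows "neg_logderiv A = D"
  using assms inverse_mult_eq_1'[of A] by (simp add: neg_logderiv_def mult.assoc flip: assms(2))

lemma neg_logderiv_mult:
  assumes "A $ 0 \<noteq> 0" "B $ 0 \<noteq> 0"
  shows "neg_logderiv (A * B) = neg_logderiv A + neg_logderiv B"
proof (rule neg_logderiv_unique)
  show "(neg_logderiv A + neg_logderiv B) * (A * B) = - fps_deriv (A * B)"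
  proof -
    have "(neg_logderiv A + neg_logderiv B) * (A * B) = (neg_logderiv A * A) * B + (neg_logderiv B * B) * A"
      by (simp add: algebra_simps)
    then show ?thesis
      unfolding neg_logderiv_times_self[OF assms(1)] neg_logderiv_times_self[OF assms(2)]
      by (simp add: algebra_simps)
  qed
qed (use assms in simp)

lemma neg_logderiv_const: "c \<noteq> 0 \<Longrightarrow> neg_logderiv (fps_const c) = 0"
  by (simp add: neg_logderiv_def)

lemma neg_logderiv_exp: "neg_logderiv (fps_exp c) = - fps_const c"
  by (rule neg_logderiv_unique) (auto simp flip: fps_const_neg)

text \<open>Only odd indices are tested: constants added to the logarithmic derivative are then
  invisible, and for an even series the odd coefficients carry all the information.\<close>

definition odd_nonneg :: "complex fps \<Rightarrow> bool" where
  "odd_nonneg A \<longleftrightarrow> (\<forall>k. odd k \<longrightarrow> neg_logderiv A $ k \<in> \<real>\<^sub>\<ge>\<^sub>0)"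

lemma odd_nonneg_mult:
  "A $ 0 \<noteq> 0 \<Longrightarrow> B $ 0 \<noteq> 0 \<Longrightarrow> odd_nonneg A \<Longrightarrow> odd_nonneg B \<Longrightarrow> odd_nonneg (A * B)"
  by (simp add: odd_nonneg_def neg_logderiv_mult)

lemma odd_nonneg_const: "c \<noteq> 0 \<Longrightarrow> odd_nonneg (fps_const c)"
  by (simp add: odd_nonneg_def neg_logderiv_const)

lemma odd_nonneg_exp: "odd_nonneg (fps_exp c)"
  by (auto simp: odd_nonneg_def neg_logderiv_exp)

lemma odd_nonneg_prod_mset:
  assumes "\<And>r. r \<in># A \<Longrightarrow> f r $ 0 \<noteq> 0 \<and> odd_nonneg (f r)"
  shows "(\<Prod>r\<in>#A. f r) $ 0 \<noteq> 0 \<and> odd_nonneg (\<Prod>r\<in>#A. f r)"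
  using assms
proof (induction A)
  case empty
  then show ?case using odd_nonneg_const[of 1] by simp
qed (simp add: odd_nonneg_mult)

lemma sum_in_nonneg_Reals: "(\<And>i. i \<in> I \<Longrightarrow> f i \<in> \<real>\<^sub>\<ge>\<^sub>0) \<Longrightarrow> (\<Sum>i\<in>I. f i :: complex) \<in> \<real>\<^sub>\<ge>\<^sub>0"
  by (induction I rule: infinite_finite_induct) auto

text \<open>Here \<open>Y\<close> is a cotangent; the real number \<open>Y $ 0\<close> may be negative, but it enters only
  the coefficients of even index to an odd power.\<close>

lemma riccati_coeffs:
  fixes Y :: "complex fps"
  assumes deriv: "fps_deriv Y = Y\<^sup>2 + fps_const (of_real b)" and b: "0 \<le> b" and y: "Y $ 0 \<in> \<real>"
  shows "if odd k then Y $ k \<in> \<real>\<^sub>\<ge>\<^sub>0 else \<exists>u\<in>\<real>\<^sub>\<ge>\<^sub>0. Y $ k = Y $ 0 * u"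
proof (induction k rule: less_induct)
  case (less k)
  show ?case
  proof (cases k)
    case 0
    then show ?thesis by (auto intro!: bexI[of _ 1])
  next
    case (Suc m)
    have "of_nat (Suc m) * Y $ Suc m = (fps_deriv Y) $ m" by simp
    also have "\<dots> = (\<Sum>i=0..m. Y $ i * Y $ (m - i)) + (if m = 0 then of_real b else 0)"
      unfolding deriv by (simp add: power2_eq_square fps_mult_nth)
    finally have eq: "Y $ Suc m = ((\<Sum>i=0..m. Y $ i * Y $ (m - i)) + (if m = 0 then of_real b else 0)) / of_nat (Suc m)"
      by (simp add: field_simps del: of_nat_Suc)
    have y2: "Y $ 0 * Y $ 0 \<in> \<real>\<^sub>\<ge>\<^sub>0"
      using y by (auto elim!: Reals_cases simp flip: of_real_mult)
    have IH: "if odd i then Y $ i \<in> \<real>\<^sub>\<ge>\<^sub>0 else \<exists>u\<in>\<real>\<^sub>\<ge>\<^sub>0. Y $ i = Y $ 0 * u" if im: "i \<le> m" for i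
      using less[of i] Suc that by auto
    show ?thesis
    proof (cases "even m")
      case True
      \<comment> \<open>The indices i and m - i have equal parity: odd factors are nonnegative
        already, and two even ones contribute the square of \<open>Y $ 0\<close>.\<close>
      have "Y $ i * Y $ (m - i) \<in> \<real>\<^sub>\<ge>\<^sub>0" if im: "i \<le> m" for i
      proof (cases "odd i")
        case False
        then obtain u where "u \<in> \<real>\<^sub>\<ge>\<^sub>0" "Y $ i = Y $ 0 * u"
          using IH[OF im] by auto
        moreover obtain v where "v \<in> \<real>\<^sub>\<ge>\<^sub>0" "Y $ (m - i) = Y $ 0 * v"
          using IH[of "m - i"] False True im by auto
        ultimately have "u \<in> \<real>\<^sub>\<ge>\<^sub>0" "v \<in> \<real>\<^sub>\<ge>\<^sub>0" "Y $ i * Y $ (m - i) = (Y $ 0 * Y $ 0) * (u * v)"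
          by simp_all
        then show ?thesis using y2 by (metis nonneg_Reals_mult_I)
      next
        case 2: True
        then have "odd (m - i)" using True that by simp
        then show ?thesis using IH[of i] IH[of "m - i"] 2 that by simp
      qed
      then have "Y $ Suc m \<in> \<real>\<^sub>\<ge>\<^sub>0"
        unfolding eq using b
        by (intro nonneg_Reals_divide_I nonneg_Reals_add_I sum_in_nonneg_Reals) (auto simp del: of_nat_Suc)
      then show ?thesis using Suc True by simp
    next
      case False
      \<comment> \<open>Exactly one of the two indices is even, so \<open>Y $ 0\<close> is left to
        the first power; the constant term of the Riccati equation does not enter for odd m.\<close>
      have "\<exists>u\<in>\<real>\<^sub>\<ge>\<^sub>0. Y $ i * Y $ (m - i) = Y $ 0 * u" if im: "i \<le> m" for i
      proof (cases "odd i")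
        case True
        then obtain v where "Y $ i \<in> \<real>\<^sub>\<ge>\<^sub>0" "v \<in> \<real>\<^sub>\<ge>\<^sub>0" "Y $ (m - i) = Y $ 0 * v"
          using IH[of i] IH[of "m - i"] False im by (auto split: if_splits)
        then show ?thesis by (intro bexI[of _ "Y $ i * v"]) auto
      next
        case 2: False
        then obtain v where "Y $ (m - i) \<in> \<real>\<^sub>\<ge>\<^sub>0" "v \<in> \<real>\<^sub>\<ge>\<^sub>0" "Y $ i = Y $ 0 * v"
          using IH[of i] IH[of "m - i"] False im by (auto split: if_splits)
        then show ?thesis by (intro bexI[of _ "Y $ (m - i) * v"]) auto
      qed
      then obtain u where u: "\<And>i. i \<le> m \<Longrightarrow> u i \<in> \<real>\<^sub>\<ge>\<^sub>0 \<and> Y $ i * Y $ (m - i) = Y $ 0 * u i"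
        by metis
      then have "Y $ Suc m = Y $ 0 * ((\<Sum>i=0..m. u i) / of_nat (Suc m))"
        unfolding eq using False by (auto simp: sum_distrib_left simp del: of_nat_Suc intro: odd_pos)
      moreover have "(\<Sum>i=0..m. u i) / of_nat (Suc m) \<in> \<real>\<^sub>\<ge>\<^sub>0"
        using u by (intro nonneg_Reals_divide_I sum_in_nonneg_Reals) (auto simp del: of_nat_Suc)
      ultimately have "\<exists>u\<in>\<real>\<^sub>\<ge>\<^sub>0. Y $ Suc m = Y $ 0 * u" by blast
      then show ?thesis using Suc False by simp
    qed
  qed
qed

text \<open>The next two lemmas concern \<open>E = e\<^bsup>i\<delta>x\<^esup>\<close>: \<open>Y\<close> is \<open>(\<delta>/2) cot ((\<theta> - \<delta>x)/2)\<close>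
  for \<open>r = e\<^bsup>i\<theta>\<^esup>\<close> in the first, and \<open>1/x - (\<delta>/2) cot (\<delta>x/2)\<close> in the second.\<close>

lemma odd_nonneg_exp_minus_unit:
  fixes \<delta> :: real
  assumes "norm r = 1" "r \<noteq> 1"
  defines "E \<equiv> fps_exp (\<i> * of_real \<delta>)"
  shows "odd_nonneg (E - fps_const r)"
proof -
  define A where "A = E - fps_const r"
  \<comment> \<open>The shift symmetrizes the quotient -E'/(E - r) to - c (E + r) / (E - r), a real
    cotangent. It changes only the coefficient of index 0.\<close>
  define Y where "Y = neg_logderiv A + fps_const (\<i> * of_real \<delta> / 2)"
  define c where "c = fps_const (\<i> * of_real \<delta> / 2)"
  have c2: "fps_const (\<i> * of_real \<delta>) = 2 * c" "fps_const ((\<delta> / 2)\<^sup>2) = - c * c"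
    unfolding c_def numeral_fps_const fps_const_neg fps_const_mult by (simp_all add: power2_eq_square algebra_simps)
  have A0: "A $ 0 \<noteq> 0" using assms by (simp add: A_def)
  have dA: "fps_deriv A = 2 * c * E" by (simp add: A_def E_def flip: c2(1))
  have dE: "fps_deriv E = 2 * c * E" by (simp add: E_def flip: c2(1))
  have YA: "Y * A = - c * (E + fps_const r)"
    using neg_logderiv_times_self[OF A0] unfolding Y_def c_def[symmetric]
    by (simp add: distrib_right dA) (simp add: A_def algebra_simps)
  \<comment> \<open>The Riccati equation is verified after clearing both denominators
    \<open>A\<close>, which can be cancelled because \<open>A\<close> is nonzero.\<close>
  have "fps_deriv Y * A * A = (Y\<^sup>2 + fps_const (of_real ((\<delta> / 2)\<^sup>2))) * A * A"
  proof -
    have "fps_deriv Y * A + Y * fps_deriv A = - c * fps_deriv E"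
      using arg_cong[OF YA, of fps_deriv] by (simp add: c_def algebra_simps)
    then have "fps_deriv Y * A = - 2 * c * c * E - Y * (2 * c * E)"
      unfolding dE dA by (simp add: algebra_simps)
    then have "fps_deriv Y * A * A = (- 2 * c * c * E - Y * (2 * c * E)) * A"
      by (simp only:)
    also have "\<dots> = - 2 * c * c * E * A - (Y * A) * (2 * c * E)"
      by (simp add: algebra_simps)
    also have "\<dots> = (Y * A) * (Y * A) - c * c * A * A"
      unfolding YA by (simp add: A_def algebra_simps)
    finally show ?thesis
      by (simp only: c2(2)) (simp add: power2_eq_square algebra_simps)
  qed
  then have deriv: "fps_deriv Y = Y\<^sup>2 + fps_const (of_real ((\<delta> / 2)\<^sup>2))"
    using A0 by (metis fps_zero_nth mult_right_cancel)
  have "Y $ 0 = - (\<i> * of_real \<delta> / 2) * ((1 + r) / (1 - r))"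
  proof -
    have "Y $ 0 * (1 - r) = - (\<i> * of_real \<delta> / 2) * (1 + r)"
      using arg_cong[OF YA, of "\<lambda>F. F $ 0"] by (simp add: A_def c_def E_def)
    then have "Y $ 0 = - (\<i> * of_real \<delta> / 2) * (1 + r) / (1 - r)"
      using assms(2) by (metis eq_divide_eq right_minus_eq)
    then show ?thesis by simp
  qed
  \<comment> \<open>The Cayley transform maps the unit circle minus 1 to the imaginary axis.\<close>
  moreover have "Re ((1 + r) / (1 - r)) = 0"
  proof -
    have "(Re r)\<^sup>2 + (Im r)\<^sup>2 = 1" using assms(1) by (simp flip: cmod_power2)
    then have "(1 + Re r) * (1 - Re r) - Im r * Im r = 0"
      by (simp add: algebra_simps power2_eq_square)
    then show ?thesis by (simp add: Re_divide)
  qed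
  ultimately have "Y $ 0 \<in> \<real>"
    by (simp only: complex_is_Real_iff times_complex.sel) simp
  from riccati_coeffs[OF deriv _ this] have "Y $ k \<in> \<real>\<^sub>\<ge>\<^sub>0" if "odd k" for k
    using that by (metis zero_le_power2)
  moreover have "Y $ k = neg_logderiv A $ k" if "odd k" for k
    using that by (auto simp: Y_def intro: odd_pos)
  ultimately show ?thesis by (simp add: odd_nonneg_def A_def)
qed

lemma odd_nonneg_exp_minus_one_div_X:
  fixes \<delta> :: real
  assumes "\<delta> \<noteq> 0" and B: "fps_X * B = fps_exp (\<i> * of_real \<delta>) - 1"
  shows "B $ 0 \<noteq> 0" "odd_nonneg B"
proof -
  define Y where "Y = neg_logderiv B + fps_const (\<i> * of_real \<delta> / 2)"
  define c where "c = fps_const (\<i> * of_real \<delta> / 2)"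
  have c2: "fps_const (\<i> * of_real \<delta>) = 2 * c" "fps_const ((\<delta> / 2)\<^sup>2) = - c * c"
    unfolding c_def numeral_fps_const fps_const_neg fps_const_mult by (simp_all add: power2_eq_square algebra_simps)
  have dc: "fps_deriv c = 0" by (simp add: c_def)
  have "B $ 0 = (fps_X * B) $ 1" by simp
  also have "\<dots> = \<i> * of_real \<delta>" unfolding B by simp
  finally show B0: "B $ 0 \<noteq> 0" using assms(1) by simp
  \<comment> \<open>\<open>K\<close> is X/(E - 1). Both \<open>fps_X * D\<close> and the derivative
    of \<open>K\<close> are polynomial in \<open>D\<close>, \<open>K\<close> and X, so
    differentiating once more lets \<open>K\<close> be eliminated.\<close>
  define K where "K = inverse B"
  have KB: "K * B = 1" using B0 by (simp add: K_def inverse_mult_eq_1)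
  define D where "D = neg_logderiv B"
  have DB: "D * B = - fps_deriv B" unfolding D_def by (rule neg_logderiv_times_self[OF B0])
  have dK: "fps_deriv K = D * K"
  proof -
    have "fps_deriv K * B + K * fps_deriv B = 0"
      using arg_cong[OF KB, of fps_deriv] by (simp add: algebra_simps)
    then have "fps_deriv K * B = K * (D * B)"
      unfolding DB by (simp add: eq_neg_iff_add_eq_0)
    then have "fps_deriv K * B = D * K * B"
      by (simp add: mult_ac)
    then show ?thesis using B0 by (metis fps_zero_nth mult_right_cancel)
  qed
  have XD: "fps_X * D = 1 - 2 * c * fps_X - 2 * c * K"
  proof -
    have "1 + fps_X * B = fps_exp (\<i> * of_real \<delta>)" by (simp add: B)
    then have "B + fps_X * fps_deriv B = 2 * c * (1 + fps_X * B)"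
      using arg_cong[OF B, of fps_deriv] by (simp add: c2 algebra_simps)
    then have "fps_X * (D * B) = B - 2 * c * fps_X * B - 2 * c * (K * B)"
      unfolding DB KB by (simp add: algebra_simps)
    then have "(fps_X * D) * B = (1 - 2 * c * fps_X - 2 * c * K) * B" by (simp add: algebra_simps)
    then show ?thesis using B0 by (metis fps_zero_nth mult_right_cancel)
  qed
  have "D + fps_X * fps_deriv D = - 2 * c - D * (2 * c * K)"
    using arg_cong[OF XD, of fps_deriv] by (simp add: dc dK algebra_simps)
  also have "2 * c * K = 1 - 2 * c * fps_X - fps_X * D" by (simp add: XD)
  finally have "fps_X * fps_deriv Y + 2 * Y = fps_X * (Y * Y - c * c)"
    unfolding Y_def D_def[symmetric] c_def[symmetric] by (simp add: dc algebra_simps)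
  then have eq: "fps_X * fps_deriv Y + 2 * Y = fps_X * (Y * Y + fps_const (of_real ((\<delta> / 2)\<^sup>2)))"
    by (simp only: c2) simp
  \<comment> \<open>In this singular Riccati equation the left side has k-th coefficient (k + 2)
    times that of \<open>Y\<close>, and the right side involves only lower indices. Thus
    \<open>Y $ 0 = 0\<close> and all coefficients are nonnegative.\<close>
  have "Y $ k \<in> \<real>\<^sub>\<ge>\<^sub>0" for k
  proof (induction k rule: less_induct)
    case (less k)
    show ?case
    proof (cases k)
      case 0
      then show ?thesis using arg_cong[OF eq, of "\<lambda>F. F $ 0"] by (simp add: numeral_fps_const)
    next
      case (Suc m)
      have "of_nat (Suc m + 2) * Y $ k = (fps_X * fps_deriv Y + 2 * Y) $ k"
        by (simp add: Suc numeral_fps_const algebra_simps)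
      also have "\<dots> = (\<Sum>i=0..m. Y $ i * Y $ (m - i)) + (if m = 0 then of_real ((\<delta> / 2)\<^sup>2) else 0)"
        unfolding eq by (simp add: Suc fps_mult_nth[of Y])
      finally have "Y $ k = ((\<Sum>i=0..m. Y $ i * Y $ (m - i)) + (if m = 0 then of_real ((\<delta> / 2)\<^sup>2) else 0)) / of_nat (Suc m + 2)"
        by (simp add: field_simps del: of_nat_Suc of_nat_add)
      also have "\<dots> \<in> \<real>\<^sub>\<ge>\<^sub>0"
        using less Suc by (intro nonneg_Reals_divide_I nonneg_Reals_add_I sum_in_nonneg_Reals nonneg_Reals_mult_I)
          (auto simp del: of_nat_Suc of_nat_add of_real_power)
      finally show ?thesis .
    qed
  qed
  then have "neg_logderiv B $ k \<in> \<real>\<^sub>\<ge>\<^sub>0" if "odd k" for k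
    using odd_pos[OF that] by (metis D_def Y_def add.right_neutral fps_add_nth fps_nth_fps_const less_numeral_extra(3))
  then show "odd_nonneg B" by (simp add: odd_nonneg_def)
qed

lemma has_fps_expansion_prod_mset:
  assumes "\<And>r. r \<in># A \<Longrightarrow> f r has_fps_expansion F r"
  shows "(\<lambda>z. \<Prod>r\<in>#A. f r z) has_fps_expansion (\<Prod>r\<in>#A. F r :: complex fps)"
  using assms by (induction A) (auto intro!: has_fps_expansion_mult)

lemma fps_sin_conv_fps_exp:
  "fps_sin (c :: complex) = fps_const (- (\<i> / 2)) * (fps_exp (\<i> * c) - fps_exp (- (\<i> * c)))"
proof -
  have "inverse (2 * \<i>) = - (\<i> / 2)" by (simp add: field_simps)
  then show ?thesis
    by (simp add: fps_sin_fps_exp_ii fps_divide_unit fps_const_inverse mult.commute)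
qed

text \<open>Substituting \<open>E\<close> into the factored \<open>sine_poly\<close> gives factors
  \<open>E - r\<close>, one factor \<open>E - 1\<close> whose zero cancels X, a constant and a pure
  exponential. All of these are \<open>odd_nonneg\<close>.\<close>

lemma odd_nonneg_sine_polynomial:
  fixes a :: "nat \<Rightarrow> real" and \<delta> :: real
  assumes a: "0 < a 0" "\<And>k. k < n \<Longrightarrow> a k \<le> a (Suc k)" and n: "0 < n" and \<delta>: "\<delta> \<noteq> 0"
    and F: "fps_X * F = (\<Sum>k\<le>n. fps_const (of_real (a k)) * fps_sin (of_real (real k * \<delta>)))"
  shows "F $ 0 \<noteq> 0" "odd_nonneg F"
proof -
  define E where "E = fps_exp (\<i> * of_real \<delta>)"
  have E: "(\<lambda>z. exp (\<i> * of_real \<delta> * z)) has_fps_expansion E"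
    unfolding E_def by (rule has_fps_expansion_exp)
  obtain A c where c: "c \<noteq> 0" and A: "\<And>r. r \<in># A \<Longrightarrow> norm r = 1 \<and> r \<noteq> 1"
    and factors: "sine_poly a n = smult c ([:-1, 1:] * (\<Prod>r\<in>#A. [:-r, 1:]))"
    using sine_poly_factorization[of a n] a n by metis
  define P where "P = (\<Prod>r\<in>#A. E - fps_const r)"
  define B where "B = fps_shift 1 (E - 1)"
  have B: "fps_X * B = E - 1"
    unfolding B_def by (rule fps_ext) (auto simp: E_def)
  \<comment> \<open>Both forms of \<open>sine_poly\<close> are expanded as analytic functions of z;
    uniqueness of expansions then gives the identity of formal series.\<close>
  have "(\<lambda>z. poly (sine_poly a n) (exp (\<i> * of_real \<delta> * z))) has_fps_expansion
      (\<Sum>k\<le>n. fps_const (of_real (a k)) * (E ^ (n + k) - E ^ (n - k)))"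
    unfolding poly_sine_poly
    by (intro has_fps_expansion_sum has_fps_expansion_mult has_fps_expansion_const
        has_fps_expansion_diff has_fps_expansion_power E)
  moreover have "(\<lambda>z. poly (sine_poly a n) (exp (\<i> * of_real \<delta> * z))) has_fps_expansion
      fps_const c * ((E - 1) * P)"
  proof -
    have "(\<lambda>z. poly (sine_poly a n) (exp (\<i> * of_real \<delta> * z))) =
        (\<lambda>z. c * ((exp (\<i> * of_real \<delta> * z) - 1) * (\<Prod>r\<in>#A. exp (\<i> * of_real \<delta> * z) - r)))"
      unfolding factors by (simp add: poly_prod_mset image_mset.compositionality o_def algebra_simps)
    then show ?thesis unfolding P_def
      by (auto intro!: has_fps_expansion_mult has_fps_expansion_const has_fps_expansion_diff
        has_fps_expansion_prod_mset E has_fps_expansion_1)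
  qed
  ultimately have "(\<Sum>k\<le>n. fps_const (of_real (a k)) * (E ^ (n + k) - E ^ (n - k))) = fps_const c * ((E - 1) * P)"
    by (rule fps_expansion_unique_complex)
  moreover have sin_eq: "fps_const (- (\<i> / 2)) * fps_exp (- (of_nat n * (\<i> * of_real \<delta>))) *
      (fps_const (of_real (a k)) * (E ^ (n + k) - E ^ (n - k))) =
      fps_const (of_real (a k)) * fps_sin (of_real (real k * \<delta>))" if "k \<le> n" for k
  proof -
    have "fps_exp (- (of_nat n * (\<i> * of_real \<delta>))) * (E ^ (n + k) - E ^ (n - k)) =
        fps_exp (\<i> * of_real (real k * \<delta>)) - fps_exp (- (\<i> * of_real (real k * \<delta>)))"
      using that unfolding E_def fps_exp_power_mult right_diff_distrib fps_exp_add_mult[symmetric]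
      by (simp add: of_nat_diff algebra_simps)
    then show ?thesis
      unfolding fps_sin_conv_fps_exp by (metis (no_types, lifting) mult.assoc mult.left_commute)
  qed
  moreover have "fps_X * F = (\<Sum>k\<le>n. fps_const (- (\<i> / 2)) * fps_exp (- (of_nat n * (\<i> * of_real \<delta>))) *
      (fps_const (of_real (a k)) * (E ^ (n + k) - E ^ (n - k))))"
    unfolding F by (intro sum.cong refl) (simp only: sin_eq atMost_iff)
  ultimately have "fps_X * F = fps_const (- (\<i> / 2)) * fps_exp (- (of_nat n * (\<i> * of_real \<delta>))) *
      (fps_const c * ((E - 1) * P))"
    by (simp only: sum_distrib_left[symmetric])
  also have "\<dots> = fps_X * (fps_const (- (\<i> / 2)) * fps_exp (- (of_nat n * (\<i> * of_real \<delta>))) *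
      (fps_const c * (B * P)))"
    by (simp add: mult_ac flip: B)
  finally have F_eq: "F = fps_const (- (\<i> / 2)) * fps_exp (- (of_nat n * (\<i> * of_real \<delta>))) *
      (fps_const c * (B * P))"
    by simp
  have P: "P $ 0 \<noteq> 0 \<and> odd_nonneg P"
    unfolding P_def
  proof (rule odd_nonneg_prod_mset)
    fix r assume "r \<in># A"
    then show "(E - fps_const r) $ 0 \<noteq> 0 \<and> odd_nonneg (E - fps_const r)"
      using A[of r] odd_nonneg_exp_minus_unit[of r \<delta>] by (auto simp: E_def)
  qed
  have B': "B $ 0 \<noteq> 0" "odd_nonneg B"
    using odd_nonneg_exp_minus_one_div_X[OF \<delta>, of B] B by (auto simp: E_def)
  show "F $ 0 \<noteq> 0" unfolding F_eq using c P B' by simp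
  show "odd_nonneg F" unfolding F_eq using c P B'
    by (intro odd_nonneg_mult odd_nonneg_const odd_nonneg_exp) auto
qed

text \<open>Each coefficient of the logarithmic derivative is a recursive expression in finitely
  many coefficients of the series, continuous where the constant term is nonzero; the nonnegative
  reals are closed.\<close>

lemma odd_nonneg_limit:
  assumes lim: "\<And>j. (\<lambda>m. A m $ j) \<longlonglongrightarrow> B $ j" and B0: "B $ 0 \<noteq> 0"
    and A: "\<And>m. A m $ 0 \<noteq> 0" "\<And>m. odd_nonneg (A m)"
  shows "odd_nonneg B"
proof -
  have rec: "neg_logderiv C $ n = (- of_nat (Suc n) * C $ Suc n - (\<Sum>i<n. neg_logderiv C $ i * C $ (n - i))) / C $ 0"
    if "C $ 0 \<noteq> 0" for C n
  proof -
    have "- of_nat (Suc n) * C $ Suc n = (neg_logderiv C * C) $ n"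
      unfolding neg_logderiv_times_self[OF that] by (simp add: algebra_simps)
    also have "\<dots> = (\<Sum>i<n. neg_logderiv C $ i * C $ (n - i)) + neg_logderiv C $ n * C $ 0"
      by (simp add: fps_mult_nth atLeast0AtMost flip: lessThan_Suc_atMost)
    finally show ?thesis using that by simp
  qed
  have "(\<lambda>m. neg_logderiv (A m) $ n) \<longlonglongrightarrow> neg_logderiv B $ n" for n
  proof (induction n rule: less_induct)
    case (less n)
    then show ?case
      unfolding rec[OF B0, of n] rec[OF A(1), of _ n] using lim B0
      by (intro tendsto_intros) auto
  qed
  then show ?thesis unfolding odd_nonneg_def
    using A(2) closed_sequentially[OF closed_nonneg_Reals_complex] by (metis odd_nonneg_def)
qed

subsection \<open>Riemann sums for the Beta integral\<close>

text \<open>The integrand may be unbounded at 1, so the sample points stop before 1. Monotonicity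
  and the mean value theorem squeeze the sum between increments of the antiderivative; nonnegativity
  of \<open>g 0\<close> pays for the first term in the lower bound.\<close>

lemma left_riemann_sum_tendsto:
  fixes g A :: "real \<Rightarrow> real"
  assumes nonneg: "0 \<le> g 0" and mono: "\<And>x y. 0 \<le> x \<Longrightarrow> x \<le> y \<Longrightarrow> y < 1 \<Longrightarrow> g x \<le> g y"
    and cont: "continuous_on {0..1} A"
    and deriv: "\<And>x. 0 < x \<Longrightarrow> x < 1 \<Longrightarrow> (A has_real_derivative g x) (at x)"
  shows "(\<lambda>n. \<Sum>k\<le>n. g (real k / real (Suc n)) / real (Suc n)) \<longlonglongrightarrow> A 1 - A 0"
proof (rule tendsto_sandwich)
  have mvt: "\<exists>x. of_nat k / real (Suc n) < x \<and> x < real (Suc k) / real (Suc n) \<and>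
      A (real (Suc k) / real (Suc n)) - A (of_nat k / real (Suc n)) = g x / real (Suc n)" if "k \<le> n" for k n
  proof -
    define u v where "u = real k / real (Suc n)" and "v = real (Suc k) / real (Suc n)"
    have uv: "0 \<le> u" "u < v" "v \<le> 1" "v - u = 1 / real (Suc n)"
      using that by (auto simp: u_def v_def divide_simps)
    have "\<exists>l x. u < x \<and> x < v \<and> (A has_real_derivative l) (at x) \<and> A v - A u = (v - u) * l"
      using uv by (intro MVT continuous_on_subset[OF cont])
        (auto simp: real_differentiable_def intro!: exI deriv)
    then obtain l x where x: "u < x" "x < v" "(A has_real_derivative l) (at x)" "A v - A u = (v - u) * l"
      by blast
    have "l = g x" using x uv deriv by (intro DERIV_unique[OF x(3)]) auto
    then show ?thesis using x uv unfolding u_def v_def by auto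
  qed
  show "\<forall>\<^sub>F n in sequentially. (\<Sum>k\<le>n. g (real k / real (Suc n)) / real (Suc n)) \<le> A 1 - A 0"
  proof (rule always_eventually, rule allI)
    fix n
    have "g (real k / real (Suc n)) / real (Suc n) \<le>
        A (real (Suc k) / real (Suc n)) - A (real k / real (Suc n))" if kn: "k \<le> n" for k
    proof -
      obtain x where x: "real k / real (Suc n) < x" "x < real (Suc k) / real (Suc n)"
        "A (real (Suc k) / real (Suc n)) - A (real k / real (Suc n)) = g x / real (Suc n)"
        using mvt[OF kn] by blast
      moreover have "real (Suc k) / real (Suc n) \<le> 1" using kn by simp
      then have "g (real k / real (Suc n)) \<le> g x"
        using x(1) by (intro mono less_le_trans[OF x(2)]) auto
      then show ?thesis using x by (simp add: divide_right_mono)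
    qed
    then have "(\<Sum>k\<le>n. g (real k / real (Suc n)) / real (Suc n)) \<le>
        (\<Sum>k\<le>n. A (real (Suc k) / real (Suc n)) - A (real k / real (Suc n)))"
      by (intro sum_mono) auto
    also have "\<dots> = A 1 - A 0"
      using sum_lessThan_telescope[of "\<lambda>k. A (real k / real (Suc n))" "Suc n"]
      by (simp add: lessThan_Suc_atMost del: of_nat_Suc sum.lessThan_Suc)
    finally show "(\<Sum>k\<le>n. g (real k / real (Suc n)) / real (Suc n)) \<le> A 1 - A 0" .
  qed
  show "\<forall>\<^sub>F n in sequentially. A (real n / real (Suc n)) - A 0 \<le> (\<Sum>k\<le>n. g (real k / real (Suc n)) / real (Suc n))"
  proof (rule always_eventually, rule allI)
    fix n
    have "A (real (Suc k) / real (Suc n)) - A (real k / real (Suc n)) \<le>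
        g (real (Suc k) / real (Suc n)) / real (Suc n)" if kn: "k < n" for k
    proof -
      obtain x where x: "real k / real (Suc n) < x" "x < real (Suc k) / real (Suc n)"
        "A (real (Suc k) / real (Suc n)) - A (real k / real (Suc n)) = g x / real (Suc n)"
        using mvt[of k n] kn by auto
      moreover have "real (Suc k) / real (Suc n) < 1" "0 \<le> real k / real (Suc n)" using kn by simp_all
      ultimately have "g x \<le> g (real (Suc k) / real (Suc n))"
        by (intro mono) linarith+
      then show ?thesis using x by (simp add: divide_right_mono)
    qed
    then have "(\<Sum>k<n. A (real (Suc k) / real (Suc n)) - A (real k / real (Suc n))) \<le>
        (\<Sum>k<n. g (real (Suc k) / real (Suc n)) / real (Suc n))"
      by (intro sum_mono) auto
    moreover have "(\<Sum>k<n. A (real (Suc k) / real (Suc n)) - A (real k / real (Suc n))) = A (real n / real (Suc n)) - A 0"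
      using sum_lessThan_telescope[of "\<lambda>k. A (real k / real (Suc n))" n] by simp
    moreover have "(\<Sum>k<n. g (real (Suc k) / real (Suc n)) / real (Suc n)) + g 0 / real (Suc n) =
        (\<Sum>k\<le>n. g (real k / real (Suc n)) / real (Suc n))"
      unfolding lessThan_Suc_atMost[symmetric] sum.lessThan_Suc_shift by simp
    moreover have "0 \<le> g 0 / real (Suc n)" using nonneg by simp
    ultimately show "A (real n / real (Suc n)) - A 0 \<le> (\<Sum>k\<le>n. g (real k / real (Suc n)) / real (Suc n))"
      by linarith
  qed
  have "(\<lambda>n. A (real n / real (Suc n))) \<longlonglongrightarrow> A 1"
    by (rule continuous_on_tendsto_compose[OF cont LIMSEQ_n_over_Suc_n]) (auto simp: divide_simps)
  then show "(\<lambda>n. A (real n / real (Suc n)) - A 0) \<longlonglongrightarrow> A 1 - A 0"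
    by (intro tendsto_intros)
qed auto

text \<open>The recursion is integration by parts.\<close>

fun beta_antideriv :: "real \<Rightarrow> nat \<Rightarrow> real \<Rightarrow> real" where
  "beta_antideriv s 0 t = - ((1 - t\<^sup>2) powr s) / (2 * s)"
| "beta_antideriv s (Suc j) t =
    (2 * (real j + 1) * beta_antideriv s j t - t ^ (2 * j + 2) * (1 - t\<^sup>2) powr s) / (2 * (real j + 1 + s))"

lemma has_real_derivative_beta_antideriv:
  assumes "0 < s" "0 < t" "t < 1"
  shows "(beta_antideriv s j has_real_derivative t ^ (2 * j + 1) * (1 - t\<^sup>2) powr (s - 1)) (at t)"
proof (induction j)
  have "t * t < 1 * 1" using assms by (intro mult_strict_mono) auto
  then have t: "0 < 1 - t\<^sup>2" by (simp add: power2_eq_square)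
  have d: "((\<lambda>t. (1 - t\<^sup>2) powr s) has_real_derivative - 2 * s * t * (1 - t\<^sup>2) powr (s - 1)) (at t)"
    using t by (auto intro!: derivative_eq_intros)
  {
    case 0
    show ?case using assms t
      by (auto intro!: derivative_eq_intros d simp: fun_eq_iff)
  next
    case (Suc j)
    define p where "p = t ^ (2 * j + 1)"
    define w where "w = (1 - t\<^sup>2) powr (s - 1)"
    have w: "(1 - t\<^sup>2) powr s = (1 - t\<^sup>2) * w"
      unfolding w_def using t by (simp add: powr_diff)
    have p: "t ^ (2 * j + 2) = t * p" "t ^ (2 * Suc j + 1) = t\<^sup>2 * p"
      by (simp_all add: p_def power2_eq_square)
    have dp: "((\<lambda>t. t ^ (2 * j + 2)) has_real_derivative 2 * (real j + 1) * p) (at t)"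
      unfolding p_def by (rule derivative_eq_intros refl)+ (simp add: algebra_simps)
    have "beta_antideriv s (Suc j) = (\<lambda>t. (2 * (real j + 1) * beta_antideriv s j t -
        t ^ (2 * j + 2) * (1 - t\<^sup>2) powr s) / (2 * (real j + 1 + s)))"
      by (rule ext) (rule beta_antideriv.simps)
    then have "(beta_antideriv s (Suc j) has_real_derivative (2 * (real j + 1) * (p * w) -
        (2 * (real j + 1) * p * (1 - t\<^sup>2) powr s + - 2 * s * t * w * t ^ (2 * j + 2))) / (2 * (real j + 1 + s))) (at t)"
      unfolding p_def w_def
      by (simp only:) (intro DERIV_cdivide DERIV_diff DERIV_cmult DERIV_mult Suc d dp[unfolded p_def])
    \<comment> \<open>Writing the power s as (1 - t^2) times the power s - 1 cancels the terms
      without the factor t^2.\<close>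
    also have "(2 * (real j + 1) * (p * w) -
        (2 * (real j + 1) * p * (1 - t\<^sup>2) powr s + - 2 * s * t * w * t ^ (2 * j + 2))) =
        2 * (real j + 1 + s) * (t\<^sup>2 * p * w)"
      unfolding w p by (simp add: algebra_simps power2_eq_square)
    finally show ?case
      using assms unfolding p w_def by simp
  }
qed

lemma continuous_on_beta_antideriv: "0 < s \<Longrightarrow> continuous_on {0..1} (beta_antideriv s j)"
proof (induction j)
  case 0
  then show ?case
    by (auto intro!: continuous_intros continuous_on_powr' simp: power_le_one)
next
  case (Suc j)
  then show ?case
    by (auto intro!: continuous_intros continuous_on_powr' simp: power_le_one)
qed

text \<open>This is half the Beta value B(j + 1, s), computed from the recursion at the endpoints,
  where the product term vanishes.\<close>

lemma beta_antideriv_diff: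
  assumes "0 < s"
  shows "beta_antideriv s j 1 - beta_antideriv s j 0 = fact j / (2 * s * pochhammer (s + 1) j)"
proof -
  have "beta_antideriv s j 1 = 0" using assms by (induction j) auto
  moreover have "beta_antideriv s j 0 = - fact j / (2 * s * pochhammer (s + 1) j)"
  proof (induction j)
    case (Suc j)
    have "pochhammer (s + 1) (Suc j) = (s + 1 + real j) * pochhammer (s + 1) j"
      by (simp add: pochhammer_rec')
    moreover have "0 < s + 1 + real j" "0 < pochhammer (s + 1) j"
      using assms by (simp_all add: pochhammer_pos)
    ultimately show ?case using assms unfolding beta_antideriv.simps Suc
      by (simp add: divide_simps) (simp add: algebra_simps)
  qed simp
  ultimately show ?thesis by simp
qed

subsection \<open>The hypergeometric series\<close>

text \<open>The series of G in the variable w for \<open>b = \<beta> + 3/2\<close>; the Pochhammer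
  symbol of the numerator parameter 1 has cancelled the factorial.\<close>

definition struve_fps :: "real \<Rightarrow> complex fps" where
  "struve_fps b = Abs_fps (\<lambda>n. (- 1 / 4) ^ n / of_real (pochhammer (3/2) n * pochhammer b n))"

text \<open>Converts the factorials of the sine series into hypergeometric coefficients.\<close>

lemma fact_odd_eq_pochhammer: "fact (2 * n + 1) = 4 ^ n * fact n * pochhammer (3/2 :: real) n"
proof (induction n)
  case (Suc n)
  have "fact (2 * Suc n + 1) = (2 * real n + 3) * (2 * real n + 2) * fact (2 * n + 1)"
    by (simp add: algebra_simps)
  also have "\<dots> = 4 ^ Suc n * fact (Suc n) * pochhammer (3/2) (Suc n)"
    unfolding Suc by (simp add: pochhammer_rec' algebra_simps)
  finally show ?case .
qed simp

text \<open>\<open>S n\<close> is the left Riemann sum of the sine transform of \<open>f\<close>,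
  and \<open>F n\<close> divides it by the variable. The weight is nondecreasing because s is at
  most 1, and the moments are Beta integrals.\<close>

lemma odd_nonneg_struve_fps_open:
  assumes "1 < b" "b \<le> 2"
  shows "odd_nonneg (struve_fps b oo fps_X\<^sup>2)"
proof -
  define s where "s = b - 1"
  have s: "0 < s" "s \<le> 1" "b = s + 1" using assms by (auto simp: s_def)
  define f where "f t = (1 - t\<^sup>2) powr (s - 1)" for t :: real
  have f_mono: "f x \<le> f y" if "0 \<le> x" "x \<le> y" "y < 1" for x y
    unfolding f_def using that s
    by (intro powr_mono2') (auto simp: abs_square_less_1 power_mono)
  define a where "a n k = f (real k / real (Suc n)) / real (Suc n)" for n k :: nat
  define S where "S n = (\<Sum>k\<le>n. fps_const (complex_of_real (a n k)) * fps_sin (of_real (real k * (1 / real (Suc n)))))" for n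
  define F where "F n = fps_shift 1 (S n)" for n
  have XF: "fps_X * F n = S n" for n
    unfolding F_def by (rule fps_ext) (auto simp: S_def fps_sum_nth)
  \<comment> \<open>The index starts at 1: \<open>S 0\<close> consists of the term with sin 0 only
    and vanishes.\<close>
  have odd: "F (Suc n) $ 0 \<noteq> 0 \<and> odd_nonneg (F (Suc n))" for n
  proof -
    have pos: "0 < a (Suc n) 0" by (simp add: a_def f_def)
    have mono: "a (Suc n) k \<le> a (Suc n) (Suc k)" if "k < Suc n" for k
      unfolding a_def using that by (intro divide_right_mono f_mono) (auto simp: divide_simps)
    have XF': "fps_X * F (Suc n) = (\<Sum>k\<le>Suc n. fps_const (of_real (a (Suc n) k)) *
        fps_sin (of_real (real k * (1 / real (Suc (Suc n))))))"
      unfolding XF S_def ..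
    show ?thesis
      using odd_nonneg_sine_polynomial[OF pos mono _ _ XF'] by simp
  qed
  have lim: "(\<lambda>n. F n $ m) \<longlonglongrightarrow> (fps_const (of_real (1 / (2 * s))) * (struve_fps b oo fps_X\<^sup>2)) $ m" for m
  proof (cases "even m")
    case False
    then have "F n $ m = 0" for n by (simp add: F_def S_def fps_sum_nth fps_sin_def)
    then show ?thesis using False by (simp add: fps_nth_compose_X_power)
  next
    case True
    then obtain j where m: "m = 2 * j" by blast
    define C where "C = (- 1) ^ j / (fact (2 * j + 1) :: real)"
    have F_nth: "F n $ m = of_real (C * (\<Sum>k\<le>n. (real k / real (Suc n)) ^ (2 * j + 1) * f (real k / real (Suc n)) / real (Suc n)))" for n
      by (simp add: F_def S_def fps_sum_nth fps_sin_def m C_def a_def sum_distrib_left mult_ac del: fact_Suc)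
    have S_lim: "(\<lambda>n. \<Sum>k\<le>n. (real k / real (Suc n)) ^ (2 * j + 1) * f (real k / real (Suc n)) / real (Suc n)) \<longlonglongrightarrow>
        beta_antideriv s j 1 - beta_antideriv s j 0"
    proof (rule left_riemann_sum_tendsto[where g = "\<lambda>t. t ^ (2 * j + 1) * f t"])
      fix x y :: real assume "0 \<le> x" "x \<le> y" "y < 1"
      then show "x ^ (2 * j + 1) * f x \<le> y ^ (2 * j + 1) * f y"
        using f_mono[of x y] by (intro mult_mono power_mono) (auto simp: f_def)
    qed (use s in \<open>auto simp: f_def intro!: continuous_on_beta_antideriv has_real_derivative_beta_antideriv[simplified]\<close>)
    have "(\<lambda>n. F n $ m) \<longlonglongrightarrow> of_real (C * (fact j / (2 * s * pochhammer (s + 1) j)))"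
      unfolding F_nth
      by (intro tendsto_of_real tendsto_mult tendsto_const S_lim[unfolded beta_antideriv_diff[OF s(1)]])
    also have "C * (fact j / (2 * s * pochhammer (s + 1) j)) =
        1 / (2 * s) * ((- 1 / 4) ^ j / (pochhammer (3/2) j * pochhammer b j))"
      unfolding C_def fact_odd_eq_pochhammer s(3) power_divide by simp
    finally show ?thesis
      using True by (simp add: fps_nth_compose_X_power struve_fps_def m)
  qed
  have "odd_nonneg (fps_const (of_real (1 / (2 * s))) * (struve_fps b oo fps_X\<^sup>2))"
    using s odd
    by (intro odd_nonneg_limit[OF LIMSEQ_Suc[OF lim]]) (simp_all add: struve_fps_def)
  moreover have "neg_logderiv (fps_const (of_real (1 / (2 * s))) * (struve_fps b oo fps_X\<^sup>2)) =
      neg_logderiv (struve_fps b oo fps_X\<^sup>2)"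
    using s by (subst neg_logderiv_mult) (auto simp: struve_fps_def neg_logderiv_const)
  ultimately show ?thesis by (simp add: odd_nonneg_def)
qed

text \<open>At b = 1 the weight is not integrable, so this endpoint is reached by letting b decrease
  to 1.\<close>

lemma odd_nonneg_struve_fps:
  assumes "1 \<le> b" "b \<le> 2"
  shows "odd_nonneg (struve_fps b oo fps_X\<^sup>2)"
proof (cases "b = 1")
  case True
  define c where "c n = 1 + 1 / real (Suc n)" for n
  have c: "1 < c n" "c n \<le> 2" for n by (auto simp: c_def divide_simps)
  have "c \<longlonglongrightarrow> 1 + 0"
    unfolding c_def by (intro tendsto_intros LIMSEQ_Suc[OF lim_1_over_n])
  then have c_lim: "c \<longlonglongrightarrow> b" using True by simp
  have "(\<lambda>n. struve_fps (c n) $ j) \<longlonglongrightarrow> struve_fps b $ j" for j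
  proof -
    have "(\<lambda>n. pochhammer (c n) j) \<longlonglongrightarrow> pochhammer b j"
      by (rule isCont_tendsto_compose[OF isCont_pochhammer c_lim])
    moreover have "pochhammer (3/2) j * pochhammer b j \<noteq> 0"
      using True pochhammer_pos[of b j] pochhammer_pos[of "3/2::real" j] by simp
    ultimately show ?thesis
      unfolding struve_fps_def fps_nth_Abs_fps
      by (intro tendsto_divide tendsto_const tendsto_of_real tendsto_mult) auto
  qed
  then have "(\<lambda>n. (struve_fps (c n) oo fps_X\<^sup>2) $ m) \<longlonglongrightarrow> (struve_fps b oo fps_X\<^sup>2) $ m" for m
    unfolding fps_nth_compose_X_power by auto
  then show ?thesis
  proof (rule odd_nonneg_limit)
    show "odd_nonneg (struve_fps (c n) oo fps_X\<^sup>2)" for n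
      using c by (rule odd_nonneg_struve_fps_open)
  qed (simp_all add: struve_fps_def)
next
  case False
  then show ?thesis using assms by (intro odd_nonneg_struve_fps_open) auto
qed

text \<open>By the chain rule, substituting X^2 turns the logarithmic derivative L into 2 X L(X^2),
  whose odd coefficients are twice those of L.\<close>

lemma neg_logderiv_struve_fps_nonneg:
  assumes "1 \<le> b" "b \<le> 2"
  shows "neg_logderiv (struve_fps b) $ n \<in> \<real>\<^sub>\<ge>\<^sub>0"
proof -
  let ?G = "struve_fps b" and ?L = "neg_logderiv (struve_fps b)"
  have G0: "?G $ 0 \<noteq> 0" by (simp add: struve_fps_def)
  have "neg_logderiv (?G oo fps_X\<^sup>2) = (?L oo fps_X\<^sup>2) * (2 * fps_X)"
  proof (rule neg_logderiv_unique)
    have "(?L oo fps_X\<^sup>2) * (?G oo fps_X\<^sup>2) = - (fps_deriv ?G oo fps_X\<^sup>2)"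
      using neg_logderiv_times_self[OF G0]
      by (simp add: fps_compose_uminus flip: fps_compose_mult_distrib)
    moreover have "fps_deriv (?G oo fps_X\<^sup>2) = (fps_deriv ?G oo fps_X\<^sup>2) * (2 * fps_X)"
      by (subst fps_compose_deriv) (auto simp: power2_eq_square)
    ultimately show "(?L oo fps_X\<^sup>2) * (2 * fps_X) * (?G oo fps_X\<^sup>2) = - fps_deriv (?G oo fps_X\<^sup>2)"
      by (simp add: mult_ac)
  qed (use G0 in simp)
  then have "neg_logderiv (?G oo fps_X\<^sup>2) $ Suc (2 * n) = 2 * (?L $ n)"
    by (simp add: fps_nth_compose_X_power numeral_fps_const mult_ac)
  then have "2 * (?L $ n) \<in> \<real>\<^sub>\<ge>\<^sub>0"
    using odd_nonneg_struve_fps[OF assms] by (metis odd_nonneg_def odd_Suc_minus_one even_mult_iff even_Suc dvd_refl even_numeral)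
  then show ?thesis by (simp add: complex_nonneg_Reals_iff)
qed

subsection \<open>Radii for functions with nonnegative logarithmic coefficients\<close>

definition real_fps :: "(nat \<Rightarrow> real) \<Rightarrow> complex fps" where
  "real_fps c = Abs_fps (\<lambda>n. of_real (c n))"

definition powser :: "(nat \<Rightarrow> real) \<Rightarrow> real \<Rightarrow> real" where
  "powser c x = (\<Sum>n. c n * x ^ n)"

text \<open>Multiplication of coefficients by n is the operator z d/dz. It keeps coefficients
  nonnegative, so the same estimates serve for the logarithm, T and z T'.\<close>

lemma real_fps_theta: "real_fps (\<lambda>n. real n * c n) = fps_X * fps_deriv (real_fps c)"
proof (rule fps_ext)
  show "real_fps (\<lambda>n. real n * c n) $ n = (fps_X * fps_deriv (real_fps c)) $ n" for n
    by (cases n) (simp_all add: real_fps_def)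
qed

context
  fixes c :: "nat \<Rightarrow> real" and \<rho> :: real
  assumes radius: "ereal \<rho> \<le> fps_conv_radius (real_fps c)"
begin

lemma summable_powser:
  assumes "0 \<le> x" "x < \<rho>"
  shows "summable (\<lambda>n. c n * x ^ n)"
proof -
  have "ereal x < ereal \<rho>" using assms by simp
  also have "\<dots> \<le> conv_radius (fps_nth (real_fps c))" using radius by (simp add: fps_conv_radius_def)
  finally have "summable (\<lambda>n. norm (fps_nth (real_fps c) n * of_real x ^ n))"
    using assms by (intro abs_summable_in_conv_radius) auto
  then have "summable (\<lambda>n. norm (c n * x ^ n))"
    using assms by (simp add: real_fps_def norm_mult norm_power abs_mult)
  then show ?thesis by (rule summable_norm_cancel)
qed

lemma eval_real_fps_of_real:
  assumes "0 \<le> x" "x < \<rho>"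
  shows "eval_fps (real_fps c) (of_real x) = of_real (powser c x)"
  unfolding eval_fps_def powser_def suminf_of_real[OF summable_powser[OF assms]]
  by (simp add: real_fps_def)

lemma norm_less_radius: "norm z < \<rho> \<Longrightarrow> ereal (norm z) < fps_conv_radius (real_fps c)"
  using radius by (metis less_ereal.simps(1) order_less_le_trans)

lemma radius_theta: "ereal \<rho> \<le> fps_conv_radius (real_fps (\<lambda>n. real n * c n))"
proof -
  have "ereal \<rho> \<le> min (fps_conv_radius (fps_X :: complex fps)) (fps_conv_radius (fps_deriv (real_fps c)))"
    using radius fps_conv_radius_deriv[of "real_fps c"] by (simp add: order.trans)
  then show ?thesis
    unfolding real_fps_theta using fps_conv_radius_mult order.trans by blast
qed

lemma eval_theta:
  assumes "norm z < \<rho>"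
  shows "eval_fps (real_fps (\<lambda>n. real n * c n)) z = z * eval_fps (fps_deriv (real_fps c)) z"
  unfolding real_fps_theta
  using assms norm_less_radius[OF assms] fps_conv_radius_deriv[of "real_fps c"]
  by (subst eval_fps_mult) (auto intro: less_le_trans)

lemma continuous_on_powser:
  assumes "y < \<rho>"
  shows "continuous_on {0..y} (powser c)"
proof -
  have "continuous_on {0..y} (\<lambda>x. Re (eval_fps (real_fps c) (of_real x)))"
    using assms by (intro continuous_intros)
      (auto simp: in_eball_iff dist_norm intro!: less_le_trans[OF _ radius])
  also have "?this \<longleftrightarrow> ?thesis"
    using assms by (intro continuous_on_cong) (auto simp: eval_real_fps_of_real)
  finally show ?thesis .
qed

context
  assumes nonneg: "\<And>n. 0 \<le> c n"
begin

lemma powser_nonneg: "0 \<le> x \<Longrightarrow> x < \<rho> \<Longrightarrow> 0 \<le> powser c x"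
  unfolding powser_def using nonneg by (intro suminf_nonneg summable_powser) auto

lemma norm_eval_le_powser:
  assumes "norm z < \<rho>"
  shows "norm (eval_fps (real_fps c) z) \<le> powser c (norm z)"
proof -
  have *: "norm (fps_nth (real_fps c) n * z ^ n) = c n * norm z ^ n" for n
    using nonneg by (simp add: real_fps_def norm_mult norm_power)
  have "norm (\<Sum>n. fps_nth (real_fps c) n * z ^ n) \<le> (\<Sum>n. norm (fps_nth (real_fps c) n * z ^ n))"
    unfolding * using assms summable_powser[of "norm z"]
    by (intro order.trans[OF summable_norm]) (simp_all add: *)
  then show ?thesis by (simp add: eval_fps_def powser_def *)
qed

text \<open>Without constant term the sum divided by x is nondecreasing. This later makes
  \<open>r\<close> the first point where Q reaches \<open>\<alpha>\<close>.\<close>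

lemma powser_scale_le:
  assumes "c 0 = 0" "0 \<le> x" "x \<le> y" "0 < y" "y < \<rho>"
  shows "powser c x \<le> x / y * powser c y"
proof -
  have "c n * x ^ n \<le> x / y * (c n * y ^ n)" for n
  proof (cases n)
    case (Suc m)
    have "c n * x ^ n = c n * (x * x ^ m)" by (simp add: Suc)
    also have "\<dots> \<le> c n * (x * y ^ m)"
      using assms nonneg by (intro mult_left_mono power_mono) auto
    also have "\<dots> = x / y * (c n * y ^ n)" using assms by (simp add: Suc)
    finally show ?thesis .
  qed (use assms in simp)
  then have "powser c x \<le> (\<Sum>n. x / y * (c n * y ^ n))"
    unfolding powser_def using assms by (intro suminf_le summable_powser summable_mult) auto
  also have "\<dots> = x / y * powser c y"
    unfolding powser_def using assms by (intro suminf_mult summable_powser) auto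
  finally show ?thesis .
qed

lemma powser_mono:
  assumes "0 \<le> x" "x \<le> y" "y < \<rho>"
  shows "powser c x \<le> powser c y"
  unfolding powser_def using assms nonneg
  by (intro suminf_le summable_powser mult_left_mono power_mono) auto

end

end

text \<open>Used for T against z T', which stops the root search before T reaches 1, and for the
  logarithm against T, which bounds G away from 0.\<close>

lemma powser_le_theta:
  assumes "ereal \<rho> \<le> fps_conv_radius (real_fps c)" "\<And>n. 0 \<le> c n" "c 0 = 0" "0 \<le> x" "x < \<rho>"
  shows "powser c x \<le> powser (\<lambda>n. real n * c n) x"
  unfolding powser_def
proof (intro suminf_le summable_powser[OF assms(1)] summable_powser[OF radius_theta[OF assms(1)]])
  fix n
  have "c n \<le> real n * c n"
    using assms(2)[of n] assms(3) mult_right_mono[of 1 "real n" "c n"] by (cases "n = 0") auto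
  then show "c n * x ^ n \<le> real n * c n * x ^ n"
    using assms by (intro mult_right_mono) auto
qed (use assms in auto)

text \<open>The hypothesis on \<open>s\<close> makes T reach 1 inside the disk of convergence, so
  the root is found there. The function \<open>f\<close> is compared with the exponential form only
  near the nonnegative axis, as principal powers may jump elsewhere.\<close>

lemma class_C_radius_of_nonneg_series:
  fixes c :: "nat \<Rightarrow> real" and \<rho> \<alpha> s :: real and f \<phi> :: "complex \<Rightarrow> complex"
  assumes radius: "ereal \<rho> \<le> fps_conv_radius (real_fps c)" and nonneg: "\<And>n. 0 \<le> c n" and c0: "c 0 = 0"
    and s: "0 < s" "s < \<rho>" "1 \<le> powser (\<lambda>n. real n * c n) s"
    and \<alpha>: "0 < \<alpha>" "\<alpha> \<le> 1" "ball 1 \<alpha> \<subseteq> \<phi> ` ball 0 1" "of_real (1 - \<alpha>) \<notin> \<phi> ` ball 0 1"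
    and f: "\<And>x. 0 \<le> x \<Longrightarrow> x < \<rho> \<Longrightarrow>
      \<forall>\<^sub>F z in nhds (of_real x). f z = z * exp (- eval_fps (real_fps c) z)"
  shows "\<exists>r. class_C_radius \<phi> f r \<and>
    smallest_positive_root (\<lambda>z. z * deriv (deriv f) z + of_real \<alpha> * deriv f z) r"
proof -
  define c1 where "c1 n = real n * c n" for n
  define c2 where "c2 n = real n * c1 n" for n
  note defs = c1_def[abs_def] c2_def[abs_def]
  have r1: "ereal \<rho> \<le> fps_conv_radius (real_fps c1)" and r2: "ereal \<rho> \<le> fps_conv_radius (real_fps c2)"
    unfolding defs by (intro radius_theta radius)+
  have n1: "0 \<le> c1 n" and n2: "0 \<le> c2 n" for n by (simp_all add: c1_def c2_def nonneg)
  have z1: "c1 0 = 0" and z2: "c2 0 = 0" by (simp_all add: c1_def c2_def)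
  define \<Lambda> T S where "\<Lambda> = eval_fps (real_fps c)" and "T = eval_fps (real_fps c1)" and "S = eval_fps (real_fps c2)"
  define h where "h z = z * exp (- \<Lambda> z)" for z
  define t where "t = powser c1"
  define u where "u = powser c2"
  have t_le_u: "t x \<le> u x" if "0 \<le> x" "x < \<rho>" for x
    unfolding t_def u_def c2_def[abs_def] using that powser_le_theta[OF r1 n1 z1] by blast

  have d\<Lambda>: "(\<Lambda> has_field_derivative eval_fps (fps_deriv (real_fps c)) z) (at z)" if "norm z < \<rho>" for z
    unfolding \<Lambda>_def using norm_less_radius[OF radius that] by (rule has_field_derivative_eval_fps)
  have dT: "(T has_field_derivative eval_fps (fps_deriv (real_fps c1)) z) (at z)" if "norm z < \<rho>" for z
    unfolding T_def using norm_less_radius[OF r1 that] by (rule has_field_derivative_eval_fps)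
  have T_eq: "T z = z * eval_fps (fps_deriv (real_fps c)) z" if "norm z < \<rho>" for z
    unfolding T_def c1_def[abs_def] using radius that by (rule eval_theta)
  have S_eq: "S z = z * eval_fps (fps_deriv (real_fps c1)) z" if "norm z < \<rho>" for z
    unfolding S_def c2_def[abs_def] using r1 that by (rule eval_theta)

  have dh: "(h has_field_derivative exp (- \<Lambda> z) * (1 - T z)) (at z)" if "norm z < \<rho>" for z
    unfolding h_def[abs_def] T_eq[OF that]
    by (rule derivative_eq_intros d\<Lambda> that refl)+ (simp add: algebra_simps)
  have h_hol: "h holomorphic_on ball 0 \<rho>"
    using dh by (intro holomorphic_onI) (auto simp: field_differentiable_def intro: has_field_derivative_at_within)
  have h': "deriv h z = exp (- \<Lambda> z) * (1 - T z)" if "norm z < \<rho>" for z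
    using dh[OF that] by (rule DERIV_imp_deriv)
  have h'': "z * deriv (deriv h) z = - exp (- \<Lambda> z) * (T z * (1 - T z) + S z)" if "norm z < \<rho>" for z
  proof -
    have "\<forall>\<^sub>F w in nhds z. w \<in> ball 0 \<rho>"
      using that by (intro eventually_nhds_in_open) auto
    then have "\<forall>\<^sub>F w in nhds z. deriv h w = exp (- \<Lambda> w) * (1 - T w)"
      by eventually_elim (simp add: h')
    then have "deriv (deriv h) z = deriv (\<lambda>w. exp (- \<Lambda> w) * (1 - T w)) z"
      by (intro deriv_cong_ev) auto
    also have "\<dots> = - exp (- \<Lambda> z) * (eval_fps (fps_deriv (real_fps c)) z * (1 - T z) + eval_fps (fps_deriv (real_fps c1)) z)"
      by (rule DERIV_imp_deriv) ((rule derivative_eq_intros d\<Lambda> dT that refl)+, simp add: algebra_simps)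
    finally have "z * deriv (deriv h) z = - exp (- \<Lambda> z) *
        ((z * eval_fps (fps_deriv (real_fps c)) z) * (1 - T z) + z * eval_fps (fps_deriv (real_fps c1)) z)"
      by (simp only:) (simp add: algebra_simps)
    then show ?thesis by (simp only: T_eq[OF that] S_eq[OF that])
  qed

  have cont: "continuous_on {0..s} t" "continuous_on {0..s} u"
    unfolding t_def u_def using s by (auto intro!: continuous_on_powser[OF r1] continuous_on_powser[OF r2])
  have t0: "t 0 = 0" and u0: "u 0 = 0" by (simp_all add: t_def u_def powser_def powser_zero z1 z2)
  have "\<exists>x\<ge>0. x \<le> s \<and> t x = 1"
    using s t0 cont by (intro IVT') (auto simp: t_def c1_def[abs_def])
  then obtain x1 where x1: "0 \<le> x1" "x1 \<le> s" "t x1 = 1" by blast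
  \<comment> \<open>\<open>R\<close> is (1 - t)(\<open>\<alpha>\<close> - Q) with the denominator
    cleared, so it makes sense also where t = 1. There it equals - u, while at 0 it equals
    \<open>\<alpha>\<close>.\<close>
  define R where "R x = (1 - t x) * (\<alpha> - t x) - u x" for x
  have "R x1 \<le> 0" using t_le_u[of x1] x1 s by (simp add: R_def)
  moreover have "0 \<le> R 0" using \<alpha> by (simp add: R_def t0 u0)
  moreover have "continuous_on {0..x1} R"
    unfolding R_def[abs_def] using x1
    by (intro continuous_intros continuous_on_subset[OF cont(1)] continuous_on_subset[OF cont(2)]) auto
  ultimately have "\<exists>x\<ge>0. x \<le> x1 \<and> R x = 0"
    using x1 by (intro IVT2') auto
  then obtain r where r: "0 \<le> r" "r \<le> x1" "R r = 0" by blast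
  have r\<rho>: "r < \<rho>" using r x1 s by simp
  have r_pos: "0 < r" using r \<alpha> by (cases "r = 0") (auto simp: R_def t0 u0)
  have "t r \<le> t x1"
    unfolding t_def using r x1 s by (intro powser_mono[OF r1 n1]) auto
  \<comment> \<open>Otherwise \<open>R r = - u r\<close>, which is at most -1.\<close>
  moreover have "t r \<noteq> 1" using t_le_u[of r] r r\<rho> by (auto simp: R_def)
  ultimately have tr: "t r < 1" using x1 by simp
  have Qr: "t r + u r / (1 - t r) = \<alpha>" using r tr by (simp add: R_def field_simps)

  \<comment> \<open>Both series scale at least linearly and 1 - t decreases, hence Q x is at most (x
    / r) times \<open>\<alpha>\<close>.\<close>
  have Q_less: "t x < 1" "t x + u x / (1 - t x) < \<alpha>" if "0 \<le> x" "x < r" for x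
  proof -
    have le: "t x \<le> x / r * t r" "u x \<le> x / r * u r" "t x \<le> t r"
      unfolding t_def u_def using that r\<rho> r_pos
        powser_scale_le[OF r1 n1 z1, of x r] powser_scale_le[OF r2 n2 z2, of x r] powser_mono[OF r1 n1, of x r]
      by simp_all
    then show "t x < 1" using tr by simp
    have "0 \<le> u x"
      unfolding u_def using that r\<rho> by (intro powser_nonneg[OF r2 n2]) auto
    then have "t x + u x / (1 - t x) \<le> x / r * t r + (x / r * u r) / (1 - t r)"
      using le tr by (intro add_mono frac_le) auto
    also have "\<dots> = x / r * \<alpha>" unfolding Qr[symmetric] by (simp add: algebra_simps)
    also have "\<dots> < 1 * \<alpha>" using that \<alpha> r_pos by (intro mult_strict_right_mono) auto
    finally show "t x + u x / (1 - t x) < \<alpha>" by simp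
  qed
  have quotient: "z * deriv (deriv h) z / deriv h z = - (T z + S z / (1 - T z))"
    if "norm z < \<rho>" "T z \<noteq> 1" for z
    unfolding h''[OF that(1)] h'[OF that(1)] using that(2) by (simp add: divide_simps)
  have real_values: "T (of_real x) = of_real (t x)" "S (of_real x) = of_real (u x)" if "0 \<le> x" "x < \<rho>" for x
    unfolding T_def S_def t_def u_def
    using eval_real_fps_of_real[OF r1 that] eval_real_fps_of_real[OF r2 that] by simp_all

  have f_h: "\<forall>\<^sub>F z in nhds (of_real x). f z = h z" if "0 \<le> x" "x < \<rho>" for x
    using f[OF that] by (simp add: h_def \<Lambda>_def)
  have in_class: "class_C_on_disk \<phi> f r"
    unfolding class_C_on_disk_def
  proof (intro exI[of _ h] conjI ballI)
    show "h holomorphic_on ball 0 r"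
      using h_hol by (rule holomorphic_on_subset) (use r\<rho> in auto)
    show "\<forall>\<^sub>F z in nhds 0. h z = f z"
      using f_h[of 0] r r\<rho> by (auto elim: eventually_mono)
    fix z :: complex assume "z \<in> ball 0 r"
    then have z: "norm z < r" "norm z < \<rho>" using r\<rho> by auto
    have bounds: "norm (T z) \<le> t (norm z)" "norm (S z) \<le> u (norm z)"
      unfolding T_def S_def t_def u_def
      using norm_eval_le_powser[OF r1 n1 z(2)] norm_eval_le_powser[OF r2 n2 z(2)] by simp_all
    have T1: "T z \<noteq> 1" using bounds(1) Q_less(1)[of "norm z"] z by auto
    show "deriv h z \<noteq> 0" unfolding h'[OF z(2)] using T1 by simp
    have "1 - t (norm z) \<le> norm (1 - T z)"
      using bounds(1) norm_triangle_ineq2[of 1 "T z"] by simp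
    then have "norm (T z + S z / (1 - T z)) \<le> t (norm z) + u (norm z) / (1 - t (norm z))"
      using bounds Q_less(1)[of "norm z"] z order.trans[OF norm_ge_zero bounds(2)]
      by (intro norm_triangle_le add_mono) (auto simp: norm_divide intro!: frac_le)
    also have "\<dots> < \<alpha>" using Q_less(2)[of "norm z"] z by simp
    finally have "1 + z * deriv (deriv h) z / deriv h z \<in> ball 1 \<alpha>"
      unfolding quotient[OF z(2) T1] by (simp add: dist_norm)
    then show "1 + z * deriv (deriv h) z / deriv h z \<in> \<phi> ` ball 0 1" using \<alpha> by blast
  qed

  have maximal: "r' \<le> r" if "class_C_on_disk \<phi> f r'" for r'
  proof (rule ccontr)
    assume "\<not> r' \<le> r"
    obtain g where g: "g holomorphic_on ball 0 r'" "\<forall>\<^sub>F z in nhds 0. g z = f z"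
      and g': "\<And>z. z \<in> ball 0 r' \<Longrightarrow> 1 + z * deriv (deriv g) z / deriv g z \<in> \<phi> ` ball 0 1"
      using \<open>class_C_on_disk \<phi> f r'\<close> unfolding class_C_on_disk_def by blast
    \<comment> \<open>\<open>g\<close> lives on the disk of radius r' and \<open>h\<close> on that
      of radius \<open>\<rho>\<close>; the two are identified on the smaller one, which still
      contains the point r.\<close>
    define m where "m = min r' \<rho>"
    have m: "r < m" "m \<le> r'" "m \<le> \<rho>" using \<open>\<not> r' \<le> r\<close> r\<rho> by (auto simp: m_def)
    have "\<forall>\<^sub>F z in nhds 0. g z = h z"
      using g(2) f_h[of 0] r r\<rho> by (auto elim: eventually_elim2)
    then obtain e where e: "0 < e" "\<And>z. norm z < e \<Longrightarrow> g z = h z"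
      unfolding eventually_nhds_metric by (auto simp: dist_norm)
    have eq: "g z = h z" if "z \<in> ball 0 m" for z
    proof (rule analytic_continuation_open[of "ball 0 (min e m)" "ball 0 m" g h])
      show "g holomorphic_on ball 0 m" "h holomorphic_on ball 0 m"
        using m by (auto intro: holomorphic_on_subset[OF g(1)] holomorphic_on_subset[OF h_hol])
      show "ball 0 (min e m) \<noteq> ({} :: complex set)" using e m r by auto
    qed (use that e in auto)
    have "\<forall>\<^sub>F z in nhds (of_real r). z \<in> ball (0::complex) m"
      using m r by (intro eventually_nhds_in_open) auto
    then have ev: "\<forall>\<^sub>F z in nhds (of_real r). g z = h z"
      by eventually_elim (rule eq)
    have "deriv g (of_real r) = deriv h (of_real r)" "deriv (deriv g) (of_real r) = deriv (deriv h) (of_real r)"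
      using higher_deriv_cong_ev[OF ev refl, of 1] higher_deriv_cong_ev[OF ev refl, of 2]
      by (simp_all add: numeral_2_eq_2)
    moreover have "1 + of_real r * deriv (deriv h) (of_real r) / deriv h (of_real r) = complex_of_real (1 - \<alpha>)"
    proof -
      have "T (of_real r) \<noteq> 1" using real_values[of r] r r\<rho> tr by simp
      then show ?thesis
        using quotient[of "of_real r"] real_values[of r] r r\<rho> unfolding Qr[symmetric] by simp
    qed
    moreover have "of_real r \<in> ball (0::complex) r'" using r m by simp
    ultimately show False using g'[of "of_real r"] \<alpha>(4) by simp
  qed

  \<comment> \<open>On the positive axis the equation is \<open>R\<close> times a nonvanishing
    exponential, so its roots are those of \<open>R\<close>.\<close>
  have root: "of_real x * deriv (deriv f) (of_real x) + of_real \<alpha> * deriv f (of_real x) =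
      exp (- \<Lambda> (of_real x)) * of_real (R x)" if "0 \<le> x" "x < \<rho>" for x
  proof -
    have derivs: "deriv f (of_real x) = deriv h (of_real x)" "deriv (deriv f) (of_real x) = deriv (deriv h) (of_real x)"
      using higher_deriv_cong_ev[OF f_h[OF that] refl, of 1] higher_deriv_cong_ev[OF f_h[OF that] refl, of 2]
      by (simp_all add: numeral_2_eq_2)
    have "norm (complex_of_real x) < \<rho>" using that by simp
    then show ?thesis
      unfolding derivs by (simp only: h' h'' real_values[OF that]) (simp add: R_def algebra_simps)
  qed
  have R_pos: "0 < R x" if "0 \<le> x" "x < r" for x
    using Q_less[OF that] by (simp add: R_def field_simps)
  have "class_C_radius \<phi> f r"
    unfolding class_C_radius_def using r_pos in_class maximal by blast
  moreover have "smallest_positive_root (\<lambda>z. z * deriv (deriv f) z + of_real \<alpha> * deriv f z) r"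
    unfolding smallest_positive_root_def
  proof (intro conjI allI impI)
    fix x assume "0 < x \<and> x < r"
    then show "of_real x * deriv (deriv f) (of_real x) + of_real \<alpha> * deriv f (of_real x) \<noteq> 0"
      using root[of x] R_pos[of x] r\<rho> by auto
  qed (use root[of r] r r_pos r\<rho> in auto)
  ultimately show ?thesis by blast
qed

subsection \<open>The logarithm of the hypergeometric function\<close>

lemma pochhammer_ge_fact:
  fixes b :: real
  assumes "1 \<le> b"
  shows "fact n \<le> pochhammer b n"
proof (induction n)
  case (Suc n)
  have "fact (Suc n) = fact n * (1 + real n)" by (simp add: algebra_simps)
  also have "\<dots> \<le> pochhammer b n * (b + real n)"
    using Suc assms pochhammer_pos[of b n] by (intro mult_mono) auto
  finally show ?case by (simp add: pochhammer_rec' mult.commute)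
qed simp

lemma struve_fps_nth_0 [simp]: "struve_fps b $ 0 = 1"
  by (simp add: struve_fps_def)

lemma fps_conv_radius_struve_fps:
  assumes "1 \<le> b"
  shows "fps_conv_radius (struve_fps b) = \<infinity>"
  unfolding fps_conv_radius_def
proof (rule conv_radius_inftyI')
  fix r :: real assume r: "0 < r"
  have "summable (\<lambda>n. struve_fps b $ n * of_real r ^ n)"
  proof (rule summable_comparison_test)
    show "summable (\<lambda>n. inverse (fact n) * r ^ n)" by (rule summable_exp)
    have "norm (struve_fps b $ n * of_real r ^ n) \<le> inverse (fact n) * r ^ n" for n
    proof -
      have ge: "1 * fact n \<le> pochhammer (3/2) n * pochhammer b n"
        using order.trans[OF fact_ge_1 pochhammer_ge_fact[of "3/2" n]] pochhammer_ge_fact[OF assms, of n]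
        by (intro mult_mono) auto
      have "norm (struve_fps b $ n) = (1 / 4) ^ n / (pochhammer (3/2) n * pochhammer b n)"
        using mult_pos_pos[OF pochhammer_pos[of "3/2" n] pochhammer_pos[of b n]] assms
        unfolding struve_fps_def fps_nth_Abs_fps norm_divide norm_power norm_of_real by simp
      also have "\<dots> \<le> 1 / fact n"
        using ge by (intro frac_le) (auto simp: power_le_one)
      finally show ?thesis
        using r by (simp add: norm_mult norm_power inverse_eq_divide mult_right_mono del: times_divide_eq_left)
    qed
    then show "\<exists>N. \<forall>n\<ge>N. norm (struve_fps b $ n * of_real r ^ n) \<le> inverse (fact n) * r ^ n" by blast
  qed
  then show "\<exists>z::complex. norm z = r \<and> summable (\<lambda>n. struve_fps b $ n * z ^ n)"
    using r by (intro exI[of _ "of_real r"]) auto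
qed

lemma hypergeo_1F2_eq_struve_fps:
  "hypergeo_1F2 1 (3/2) (of_real b) (- (w / 4)) = eval_fps (struve_fps b) w"
proof -
  have "fps_hypergeo [1] [3/2, of_real b] 1 $ n * (- (w / 4)) ^ n = struve_fps b $ n * w ^ n" for n
  proof -
    have "(- (w / 4)) ^ n = (- 1 / 4) ^ n * w ^ n" by (simp flip: power_mult_distrib)
    moreover have "complex_of_real (pochhammer (3/2) n) = pochhammer (3/2) n"
      by (simp flip: pochhammer_of_real)
    ultimately show ?thesis
      by (simp add: struve_fps_def pochhammer_of_real flip: pochhammer_fact)
  qed
  then show ?thesis by (simp add: hypergeo_1F2_def eval_fps_def)
qed

text \<open>These are the Taylor coefficients of \<open>- log\<close> of the hypergeometric function; division by
  zero gives the right value \<open>0\<close> at \<open>n = 0\<close>.\<close>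

definition struve_log_coeff :: "real \<Rightarrow> nat \<Rightarrow> real" where
  "struve_log_coeff b n = Re (neg_logderiv (struve_fps b) $ (n - 1)) / real n"

lemma struve_log_coeff_0 [simp]: "struve_log_coeff b 0 = 0"
  by (simp add: struve_log_coeff_def)

text \<open>If G had no zeros, this linear coefficient alone would make T at least 1 at the point 6
  b.\<close>

lemma struve_log_coeff_1: "struve_log_coeff b 1 = 1 / (6 * b)"
  by (simp add: struve_log_coeff_def neg_logderiv_def struve_fps_def Re_divide power2_eq_square)

context
  fixes b :: real
  assumes b: "1 \<le> b" "b \<le> 2"
begin

lemma struve_log_coeff_nonneg: "0 \<le> struve_log_coeff b n"
  using neg_logderiv_struve_fps_nonneg[OF b, of "n - 1"]
  by (simp add: struve_log_coeff_def complex_nonneg_Reals_iff)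

text \<open>A zero-free disk carries a holomorphic logarithm. Its expansion is identified through
  the logarithmic derivative, and its holomorphy gives the radius of convergence.\<close>

lemma eval_struve_fps_eq_exp:
  assumes "0 < \<rho>" and nonzero: "\<And>w. norm w < \<rho> \<Longrightarrow> eval_fps (struve_fps b) w \<noteq> 0"
  shows "ereal \<rho> \<le> fps_conv_radius (real_fps (struve_log_coeff b))"
    and "\<And>w. norm w < \<rho> \<Longrightarrow> eval_fps (struve_fps b) w = exp (- eval_fps (real_fps (struve_log_coeff b)) w)"
proof -
  define G where "G = eval_fps (struve_fps b)"
  have G_hol: "G holomorphic_on A" for A
    unfolding G_def using fps_conv_radius_struve_fps[OF b(1)] by (intro holomorphic_intros) auto
  have G_fps: "G has_fps_expansion struve_fps b"
    unfolding G_def using fps_conv_radius_struve_fps[OF b(1)] by (intro eval_fps_has_fps_expansion) simp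
  obtain g0 where g0: "g0 holomorphic_on ball 0 \<rho>" "\<And>w. w \<in> ball 0 \<rho> \<Longrightarrow> G w = exp (g0 w)"
    using contractible_imp_holomorphic_log[OF G_hol, of "ball 0 \<rho>"] nonzero
    by (auto simp: G_def convex_imp_contractible)
  define \<Lambda> where "\<Lambda> w = g0 0 - g0 w" for w
  \<comment> \<open>Subtracting \<open>g0 0\<close> normalizes the logarithm to 0 at the origin
    without changing its exponential.\<close>
  have exp_g0: "exp (g0 0) = 1"
    using g0(2)[of 0] assms(1) by (simp add: G_def eval_fps_at_0)
  have \<Lambda>_hol: "\<Lambda> holomorphic_on ball 0 \<rho>"
    unfolding \<Lambda>_def[abs_def] by (intro holomorphic_intros g0)
  have G_exp: "G w = exp (- \<Lambda> w)" if "norm w < \<rho>" for w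
    using g0(2)[of w] exp_g0 that by (simp add: \<Lambda>_def exp_diff)
  obtain A where A: "\<Lambda> has_fps_expansion A"
    using has_fps_expansion_fps_expansion[OF open_ball _ \<Lambda>_hol] assms(1) by auto
  have "deriv G w = - deriv \<Lambda> w * G w" if "w \<in> ball 0 \<rho>" for w
  proof -
    have "\<forall>\<^sub>F z in nhds w. z \<in> ball 0 \<rho>" using that by (intro eventually_nhds_in_open) auto
    then have "\<forall>\<^sub>F z in nhds w. G z = exp (- \<Lambda> z)"
      by eventually_elim (simp add: G_exp)
    then have "deriv G w = deriv (\<lambda>z. exp (- \<Lambda> z)) w" by (intro deriv_cong_ev) auto
    also have "\<dots> = exp (- \<Lambda> w) * (- deriv \<Lambda> w)"
      by (rule DERIV_imp_deriv)
        (auto intro!: derivative_eq_intros holomorphic_derivI[OF \<Lambda>_hol _ that])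
    finally show ?thesis using that G_exp[of w] by simp
  qed
  moreover have "\<forall>\<^sub>F w in nhds (0::complex). w \<in> ball 0 \<rho>"
    using assms(1) by (intro eventually_nhds_in_open) auto
  ultimately have ev: "\<forall>\<^sub>F w in nhds 0. deriv G w = - deriv \<Lambda> w * G w"
    by (auto elim: eventually_mono)
  have "deriv G has_fps_expansion - fps_deriv A * struve_fps b"
    using ev by (subst has_fps_expansion_cong[OF _ refl, of _ "\<lambda>w. - deriv \<Lambda> w * G w"])
      (auto intro!: has_fps_expansion_mult has_fps_expansion_minus has_fps_expansion_deriv A G_fps)
  then have "fps_deriv A * struve_fps b = - fps_deriv (struve_fps b)"
    using fps_expansion_unique_complex[OF has_fps_expansion_deriv[OF G_fps]] by fastforce
  then have deriv_A: "neg_logderiv (struve_fps b) = fps_deriv A"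
    by (intro neg_logderiv_unique) auto
  have "A $ n = of_real (struve_log_coeff b n)" for n
  proof (cases n)
    case 0
    have "A $ 0 = \<Lambda> 0" using has_fps_expansion_imp_0_eq_fps_nth_0[OF A] by simp
    then show ?thesis by (simp add: 0 \<Lambda>_def)
  next
    case (Suc m)
    have "fps_deriv A $ m \<in> \<real>\<^sub>\<ge>\<^sub>0"
      using neg_logderiv_struve_fps_nonneg[OF b, of m] by (simp only: deriv_A)
    then have "of_real (Re (fps_deriv A $ m)) = fps_deriv A $ m"
      by (simp only: complex_nonneg_Reals_iff complex_eq_iff) simp
    then have "of_real (struve_log_coeff b n) = fps_deriv A $ m / of_nat n"
      unfolding struve_log_coeff_def deriv_A Suc by (simp del: fps_deriv_nth of_nat_Suc)
    then show ?thesis by (simp add: Suc del: of_nat_Suc)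
  qed
  then have A_eq: "A = real_fps (struve_log_coeff b)"
    by (intro fps_ext) (simp add: real_fps_def)
  have "\<Lambda> holomorphic_on eball 0 (ereal \<rho>)" using \<Lambda>_hol by simp
  then show "ereal \<rho> \<le> fps_conv_radius (real_fps (struve_log_coeff b))"
    using holomorphic_on_imp_fps_conv_radius_ge[OF A] by (simp only: A_eq)
  show "eval_fps (struve_fps b) w = exp (- eval_fps (real_fps (struve_log_coeff b)) w)" if "norm w < \<rho>" for w
    using G_exp[OF that] has_fps_expansion_imp_eval_fps_eq[OF A that \<Lambda>_hol] by (simp add: A_eq G_def)
qed

text \<open>Existence of a zero of G is left open: without zeros the linear term suffices, otherwise
  the disk extends to the nearest zero.\<close>

lemma struve_fps_zero_free_disk:
  obtains \<rho> s where "0 < s" "s < \<rho>" "\<And>w. norm w < \<rho> \<Longrightarrow> eval_fps (struve_fps b) w \<noteq> 0"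
    "1 \<le> powser (\<lambda>n. real n * struve_log_coeff b n) s"
proof -
  define G where "G = eval_fps (struve_fps b)"
  define c where "c = struve_log_coeff b"
  have c: "\<And>n. 0 \<le> c n" "c 0 = 0" by (simp_all add: c_def struve_log_coeff_nonneg)
  have cont: "continuous_on UNIV G"
    unfolding G_def using fps_conv_radius_struve_fps[OF b(1)] by (intro continuous_intros) auto
  define Z where "Z = {w. G w = 0}"
  have "closed Z" unfolding Z_def using cont by (intro closed_Collect_eq continuous_intros)
  show thesis
  proof (cases "Z = {}")
    case True
    have rad: "ereal (6 * b + 1) \<le> fps_conv_radius (real_fps c)"
      unfolding c_def using True b by (intro eval_struve_fps_eq_exp) (auto simp: Z_def G_def)
    have "(\<Sum>n\<in>{1}. real n * c n * (6 * b) ^ n) \<le> powser (\<lambda>n. real n * c n) (6 * b)"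
      unfolding powser_def using b c summable_powser[OF radius_theta[OF rad], of "6 * b"]
      by (intro sum_le_suminf) auto
    then have "1 \<le> powser (\<lambda>n. real n * c n) (6 * b)"
      using b by (simp add: c_def struve_log_coeff_1[unfolded One_nat_def])
    then show thesis
      using that[of "6 * b" "6 * b + 1"] True b by (auto simp: Z_def G_def c_def)
  next
    case False
    then obtain w0 where w0: "w0 \<in> Z" "\<And>w. w \<in> Z \<Longrightarrow> dist 0 w0 \<le> dist 0 w"
      using distance_attains_inf[OF \<open>closed Z\<close>, of 0] by blast
    define \<rho> where "\<rho> = norm w0"
    have "w0 \<noteq> 0" using w0(1) by (auto simp: Z_def G_def eval_fps_at_0)
    then have \<rho>: "0 < \<rho>" by (simp add: \<rho>_def)
    have nz: "eval_fps (struve_fps b) w \<noteq> 0" if "norm w < \<rho>" for w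
      using w0(2)[of w] that by (auto simp: Z_def G_def \<rho>_def)
    note rad = eval_struve_fps_eq_exp(1)[OF \<rho> nz, folded c_def]
    \<comment> \<open>If T stayed below 1, the logarithm would be bounded by 1 on the disk, so the
      norm of G would be at least exp (-1) there and, by continuity, at the boundary zero
      \<open>w0\<close>.\<close>
    have "\<exists>s. 0 < s \<and> s < \<rho> \<and> 1 \<le> powser (\<lambda>n. real n * c n) s"
    proof (rule ccontr)
      assume "\<not> ?thesis"
      then have less: "powser (\<lambda>n. real n * c n) s < 1" if "0 < s" "s < \<rho>" for s
        using that by force
      have "exp (- 1) \<le> norm (G w)" if "norm w < \<rho>" for w
      proof -
        have "norm (eval_fps (real_fps c) w) \<le> powser c (norm w)"
          using norm_eval_le_powser[OF rad c(1) that] .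
        also have "\<dots> \<le> powser (\<lambda>n. real n * c n) (norm w)"
          using powser_le_theta[OF rad c] that by simp
        also have "\<dots> \<le> 1"
        proof (cases "w = 0")
          case True
          then show ?thesis by (simp add: powser_def powser_zero)
        qed (use less[of "norm w"] that in simp)
        finally have "- 1 \<le> Re (- eval_fps (real_fps c) w)"
          using complex_Re_le_cmod[of "eval_fps (real_fps c) w"] by simp
        then show ?thesis
          using eval_struve_fps_eq_exp(2)[OF \<rho> nz that, folded c_def] by (simp add: G_def)
      qed
      then have "ball 0 \<rho> \<subseteq> {w. exp (- 1) \<le> norm (G w)}" by auto
      then have "closure (ball 0 \<rho>) \<subseteq> {w. exp (- 1) \<le> norm (G w)}"
        using cont by (intro closure_minimal closed_Collect_le continuous_intros)
      then have "w0 \<in> {w. exp (- 1) \<le> norm (G w)}"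
        using \<rho> by (auto simp: \<rho>_def)
      then show False using w0(1) by (simp add: Z_def)
    qed
    then show thesis using that nz by (auto simp: c_def)
  qed
qed

end

text \<open>Passes from the logarithm of G to that of a power of G at z^d: U and V have d = 2, W has
  d = 1, and the operator z d/dz gains the factor d.\<close>

lemma real_fps_compose_power:
  fixes c :: "nat \<Rightarrow> real" and \<gamma> \<rho> :: real and d :: nat
  assumes "ereal \<rho> \<le> fps_conv_radius (real_fps c)" "0 < d" "0 < \<rho>"
  defines "c' \<equiv> \<lambda>n. if d dvd n then \<gamma> * c (n div d) else 0"
  shows "ereal (root d \<rho>) \<le> fps_conv_radius (real_fps c')"
    and "norm z < root d \<rho> \<Longrightarrow> eval_fps (real_fps c') z = of_real \<gamma> * eval_fps (real_fps c) (z ^ d)"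
    and "0 \<le> s \<Longrightarrow> s < \<rho> \<Longrightarrow> powser (\<lambda>n. real n * c' n) (root d s) = real d * \<gamma> * powser (\<lambda>n. real n * c n) s"
proof -
  have mono: "strict_mono (\<lambda>n. d * n)" using assms(2) by (intro strict_monoI) simp
  have range: "n \<in> range (\<lambda>n. d * n) \<longleftrightarrow> d dvd n" for n by auto
  have sums: "(\<lambda>n. real_fps c' $ n * z ^ n) sums (of_real \<gamma> * eval_fps (real_fps c) (z ^ d))"
    if "norm z < root d \<rho>" for z
  proof -
    have "norm z ^ d < root d \<rho> ^ d"
      using that assms(2) by (intro power_strict_mono) auto
    then have "norm (z ^ d) < \<rho>" using assms(2,3) by (simp add: norm_power)
    then have "(\<lambda>n. real_fps c $ n * (z ^ d) ^ n) sums eval_fps (real_fps c) (z ^ d)"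
      using norm_less_radius[OF assms(1)] by (intro sums_eval_fps) auto
    then have "(\<lambda>n. of_real \<gamma> * (real_fps c $ n * (z ^ d) ^ n)) sums (of_real \<gamma> * eval_fps (real_fps c) (z ^ d))"
      by (rule sums_mult)
    also have "(\<lambda>n. of_real \<gamma> * (real_fps c $ n * (z ^ d) ^ n)) = (\<lambda>n. real_fps c' $ (d * n) * z ^ (d * n))"
      using assms(2) by (simp add: real_fps_def c'_def mult_ac flip: power_mult)
    finally show ?thesis
      by (subst (asm) sums_mono_reindex[OF mono, of "\<lambda>n. real_fps c' $ n * z ^ n"])
        (auto simp: range real_fps_def c'_def)
  qed
  show "ereal (root d \<rho>) \<le> fps_conv_radius (real_fps c')"
    unfolding fps_conv_radius_def
  proof (rule conv_radius_geI_ex')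
    fix r assume "0 < r" "ereal r < ereal (root d \<rho>)"
    then show "summable (\<lambda>n. real_fps c' $ n * of_real r ^ n)"
      using sums[of "of_real r"] by (auto simp: sums_iff)
  qed
  show "eval_fps (real_fps c') z = of_real \<gamma> * eval_fps (real_fps c) (z ^ d)" if "norm z < root d \<rho>"
    using sums[OF that] by (simp add: eval_fps_def sums_iff)
  show "powser (\<lambda>n. real n * c' n) (root d s) = real d * \<gamma> * powser (\<lambda>n. real n * c n) s" if "0 \<le> s" "s < \<rho>"
  proof -
    have "(\<lambda>n. real n * c n * s ^ n) sums powser (\<lambda>n. real n * c n) s"
      unfolding powser_def by (intro summable_sums summable_powser[OF radius_theta[OF assms(1)]] that)
    then have "(\<lambda>n. (real d * \<gamma>) * (real n * c n * s ^ n)) sums ((real d * \<gamma>) * powser (\<lambda>n. real n * c n) s)"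
      by (rule sums_mult)
    also have "(\<lambda>n. (real d * \<gamma>) * (real n * c n * s ^ n)) = (\<lambda>n. real (d * n) * c' (d * n) * root d s ^ (d * n))"
      using assms(2) that by (intro ext) (simp add: c'_def power_mult)
    finally have "(\<lambda>n. real n * c' n * root d s ^ n) sums (real d * \<gamma> * powser (\<lambda>n. real n * c n) s)"
      by (subst (asm) sums_mono_reindex[OF mono, of "\<lambda>n. real n * c' n * root d s ^ n"])
        (auto simp: range c'_def)
    then show ?thesis by (simp add: powser_def sums_iff)
  qed
qed

subsection \<open>The radii of the Struve functions\<close>

lemma largest_disk_radius_le_1:
  assumes "ma_minda \<phi>" "largest_disk_radius (\<phi> ` ball 0 1) 1 \<alpha>"
  shows "\<alpha> \<le> 1"
proof (rule ccontr)
  assume "\<not> \<alpha> \<le> 1"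
  then have "0 \<in> \<phi> ` ball 0 1"
    using assms(2) by (auto simp: largest_disk_radius_def subset_iff)
  then show False using assms(1) by (auto simp: ma_minda_def)
qed

text \<open>If l were the value at z, openness would force the values near -1 into the image of a
  small ball about z. Injectivity would then put points near -1 into that ball, which stays away
  from the unit circle.\<close>

lemma radial_limit_notin_image:
  fixes \<phi> :: "complex \<Rightarrow> complex"
  assumes hol: "\<phi> holomorphic_on ball 0 1" and inj: "inj_on \<phi> (ball 0 1)"
    and lim: "((\<lambda>x. \<phi> (of_real x)) \<longlongrightarrow> l) (at_right (-1 :: real))"
  shows "l \<notin> \<phi> ` ball 0 1"
proof
  assume "l \<in> \<phi> ` ball 0 1"
  then obtain z where z: "norm z < 1" "\<phi> z = l" by auto
  define e where "e = (1 - norm z) / 2"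
  have e: "0 < e" "norm z + e < 1" using z by (auto simp: e_def field_simps)
  have sub: "ball z e \<subseteq> ball 0 1"
  proof
    fix w assume "w \<in> ball z e"
    then show "w \<in> ball 0 1"
      using e norm_triangle_ineq2[of w z] by (simp add: dist_norm norm_minus_commute)
  qed
  have "open (\<phi> ` ball z e)"
  proof (rule open_mapping_thm3)
    show "\<phi> holomorphic_on ball z e" using hol sub by (rule holomorphic_on_subset)
    show "inj_on \<phi> (ball z e)" using inj sub by (rule inj_on_subset)
  qed simp
  moreover have "l \<in> \<phi> ` ball z e" using z e by auto
  ultimately have "\<forall>\<^sub>F x in at_right (-1). \<phi> (of_real x) \<in> \<phi> ` ball z e"
    using lim by (auto dest: topological_tendstoD)
  moreover have "\<forall>\<^sub>F x in at_right (-1). x \<in> {-1<..<- norm z - e}"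
    using e by (intro eventually_at_right_real) auto
  ultimately have "\<forall>\<^sub>F x in at_right (-1::real). False"
  proof eventually_elim
    case (elim x)
    then obtain w where w: "w \<in> ball z e" "\<phi> (of_real x) = \<phi> w" by blast
    have "x < - norm z - e" using elim by simp
    then have "x < 0" using e norm_ge_zero[of z] by linarith
    then have "complex_of_real x \<in> ball 0 1" using elim by auto
    then have "of_real x = w" using inj_onD[OF inj w(2)] w(1) sub by blast
    then have "norm (z - of_real x) < e" using w(1) by (simp add: dist_norm)
    then have "\<bar>x\<bar> < norm z + e"
      using norm_triangle_ineq2[of "of_real x" z] by (simp add: norm_minus_commute)
    then show ?case using elim \<open>x < 0\<close> by auto
  qed
  then show False by (simp add: trivial_limit_at_right_real)
qed

text \<open>The bound on the imaginary part keeps the logarithm on its principal branch.\<close>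

lemma exp_minus_powr_of_real:
  assumes "\<bar>Im w\<bar> < pi"
  shows "exp (- w) powr of_real \<gamma> = exp (- (of_real \<gamma> * w))"
  using assms by (simp add: powr_def Ln_exp)

theorem theorem3p3:
  fixes \<beta> \<alpha> :: real and \<phi> :: "complex \<Rightarrow> complex"
  assumes "\<bar>\<beta>\<bar> \<le> 1/2"
    and "ma_minda \<phi>"
    and "largest_disk_radius (\<phi> ` ball 0 1) 1 \<alpha>"
    and "((\<lambda>x. \<phi> (of_real x)) \<longlongrightarrow> of_real (1 - \<alpha>)) (at_right (-1 :: real))"
  shows "(\<exists>r. class_C_radius \<phi> (struve_U \<beta>) r \<and>
           smallest_positive_root
             (\<lambda>z. z * deriv (deriv (struve_U \<beta>)) z + of_real \<alpha> * deriv (struve_U \<beta>) z) r)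
       \<and> (\<exists>r. class_C_radius \<phi> (struve_V \<beta>) r \<and>
           smallest_positive_root
             (\<lambda>z. z * deriv (deriv (struve_V \<beta>)) z + of_real \<alpha> * deriv (struve_V \<beta>) z) r)
       \<and> (\<exists>r. class_C_radius \<phi> (struve_W \<beta>) r \<and>
           smallest_positive_root
             (\<lambda>z. z * deriv (deriv (struve_W \<beta>)) z + of_real \<alpha> * deriv (struve_W \<beta>) z) r)"
proof -
  define b where "b = \<beta> + 3/2"
  have \<beta>: "- 1/2 \<le> \<beta>" "\<beta> \<le> 1/2" using assms(1) by auto
  then have b: "1 \<le> b" "b \<le> 2" and \<beta>': "- 3/2 < \<beta>" by (auto simp: b_def)
  have \<alpha>: "0 < \<alpha>" "\<alpha> \<le> 1" "ball 1 \<alpha> \<subseteq> \<phi> ` ball 0 1" "of_real (1 - \<alpha>) \<notin> \<phi> ` ball 0 1"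
    using assms(3) largest_disk_radius_le_1[OF assms(2,3)] assms(2) radial_limit_notin_image[OF _ _ assms(4)]
    by (auto simp: largest_disk_radius_def ma_minda_def)
  define c where "c = struve_log_coeff b"
  define G where "G = eval_fps (struve_fps b)"
  define \<Lambda> where "\<Lambda> = eval_fps (real_fps c)"
  have c: "\<And>n. 0 \<le> c n" "c 0 = 0" using struve_log_coeff_nonneg[OF b] by (auto simp: c_def)
  obtain \<rho> s where s: "0 < s" "s < \<rho>" "1 \<le> powser (\<lambda>n. real n * c n) s"
    and nz: "\<And>w. norm w < \<rho> \<Longrightarrow> eval_fps (struve_fps b) w \<noteq> 0"
    using struve_fps_zero_free_disk[OF b] unfolding c_def by metis
  have \<rho>: "0 < \<rho>" using s by simp
  have radius: "ereal \<rho> \<le> fps_conv_radius (real_fps c)"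
    unfolding c_def by (rule eval_struve_fps_eq_exp(1)[OF b \<rho> nz])
  have G_exp: "G w = exp (- \<Lambda> w)" if "norm w < \<rho>" for w
    unfolding c_def G_def \<Lambda>_def by (rule eval_struve_fps_eq_exp(2)[OF b \<rho> nz that])

  \<comment> \<open>The condition on \<open>real d * \<gamma>\<close> ensures that T, multiplied by
    this factor, still reaches 1 at \<open>root d s\<close>.\<close>
  have main: "\<exists>r. class_C_radius \<phi> f r \<and>
      smallest_positive_root (\<lambda>z. z * deriv (deriv f) z + of_real \<alpha> * deriv f z) r"
    if d: "0 < d" "1 \<le> real d * \<gamma>"
      and f: "\<And>x. 0 \<le> x \<Longrightarrow> x < root d \<rho> \<Longrightarrow>
        \<forall>\<^sub>F z in nhds (of_real x). f z = z * exp (- (of_real \<gamma> * \<Lambda> (z ^ d)))" for f \<gamma> d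
  proof -
    define c' where "c' n = (if d dvd n then \<gamma> * c (n div d) else 0)" for n
    note comp = real_fps_compose_power[OF radius d(1) \<rho>, where \<gamma> = \<gamma>, folded c'_def]
    have "0 < \<gamma>" using d by (metis less_le_trans of_nat_0_less_iff zero_less_mult_pos zero_less_one)
    show ?thesis
    proof (rule class_C_radius_of_nonneg_series[OF comp(1) _ _ _ _ _ \<alpha>])
      show "0 \<le> c' n" "c' 0 = 0" for n using c \<open>0 < \<gamma>\<close> by (auto simp: c'_def)
      show "0 < root d s" "root d s < root d \<rho>" using s d by auto
      have "1 * 1 \<le> (real d * \<gamma>) * powser (\<lambda>n. real n * c n) s"
        using s d by (intro mult_mono) auto
      then show "1 \<le> powser (\<lambda>n. real n * c' n) (root d s)"
        using comp(3)[of s] s by simp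
      fix x assume x: "0 \<le> x" "x < root d \<rho>"
      have "\<forall>\<^sub>F z in nhds (of_real x). z \<in> ball (0::complex) (root d \<rho>)"
        using x by (intro eventually_nhds_in_open) auto
      with f[OF x] show "\<forall>\<^sub>F z in nhds (of_real x). f z = z * exp (- eval_fps (real_fps c') z)"
        by eventually_elim (simp add: comp(2) \<Lambda>_def)
    qed
  qed

  have norm_power_less: "norm (z ^ d) < \<rho>" if "norm z < root d \<rho>" "0 < d" for z :: complex and d
  proof -
    have "norm z ^ d < root d \<rho> ^ d" using that by (intro power_strict_mono) auto
    then show ?thesis using that \<rho> by (simp add: norm_power)
  qed
  have ev_ball: "\<forall>\<^sub>F z in nhds (complex_of_real x). norm (z ^ d) < \<rho>"
    if "0 \<le> x" "x < root d \<rho>" "0 < d" for x d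
  proof -
    have "\<forall>\<^sub>F z in nhds (of_real x). z \<in> ball (0::complex) (root d \<rho>)"
      using that by (intro eventually_nhds_in_open) auto
    then show ?thesis by eventually_elim (use that norm_power_less in simp)
  qed

  have U: "struve_U \<beta> z = z * G (z\<^sup>2) powr of_real (1 / (\<beta> + 1))" for z
    unfolding struve_U_def G_def b_def using hypergeo_1F2_eq_struve_fps[of b "z\<^sup>2"] by (simp add: b_def)
  have V: "struve_V \<beta> z = z * G (z\<^sup>2)" for z
    unfolding struve_V_eq[OF \<beta>'] G_def using hypergeo_1F2_eq_struve_fps[of b "z\<^sup>2"] by (simp add: b_def)
  have W: "struve_W \<beta> z = z * G z" for z
    unfolding struve_W_eq[OF \<beta>'] G_def using hypergeo_1F2_eq_struve_fps[of b z] by (simp add: b_def)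

  \<comment> \<open>The logarithm is real at real points, so nearby its imaginary part is below pi
    and the principal power equals the exponential form.\<close>
  have fU: "\<forall>\<^sub>F z in nhds (of_real x). struve_U \<beta> z = z * exp (- (of_real (1 / (\<beta> + 1)) * \<Lambda> (z ^ 2)))"
    if x: "0 \<le> x" "x < root 2 \<rho>" for x
  proof -
    have "norm (complex_of_real x ^ 2) < \<rho>"
      using x by (intro norm_power_less) auto
    then have x2: "x\<^sup>2 < \<rho>" by (simp add: norm_power)
    have "isCont \<Lambda> ((of_real x)\<^sup>2)"
      unfolding \<Lambda>_def using x2
      by (intro continuous_eval_fps norm_less_radius[OF radius]) (simp add: norm_power)
    then have "isCont (\<lambda>z. Im (\<Lambda> (z\<^sup>2))) (of_real x)"
      by (intro continuous_Im isCont_o2[of _ "\<lambda>z. z\<^sup>2" \<Lambda>]) (auto intro!: continuous_intros)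
    then have "((\<lambda>z. Im (\<Lambda> (z\<^sup>2))) \<longlongrightarrow> Im (\<Lambda> ((of_real x)\<^sup>2))) (nhds (of_real x))"
      by (simp only: isCont_def tendsto_at_iff_tendsto_nhds[of "\<lambda>z. Im (\<Lambda> (z\<^sup>2))"])
    moreover have "Im (\<Lambda> ((of_real x)\<^sup>2)) = 0"
      using eval_real_fps_of_real[OF radius _ x2] by (simp add: \<Lambda>_def)
    ultimately have "((\<lambda>z. Im (\<Lambda> (z\<^sup>2))) \<longlongrightarrow> 0) (nhds (of_real x))"
      by simp
    then have "\<forall>\<^sub>F z in nhds (of_real x). dist (Im (\<Lambda> (z\<^sup>2))) 0 < pi"
      by (rule tendstoD) simp
    with ev_ball[OF x pos2] show ?thesis
      by eventually_elim (simp add: U G_exp exp_minus_powr_of_real del: of_real_divide)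
  qed
  have "\<forall>\<^sub>F z in nhds (of_real x). struve_V \<beta> z = z * exp (- (of_real 1 * \<Lambda> (z ^ 2)))"
    if "0 \<le> x" "x < root 2 \<rho>" for x
    using ev_ball[OF that pos2] by eventually_elim (simp add: V G_exp)
  moreover have "\<forall>\<^sub>F z in nhds (of_real x). struve_W \<beta> z = z * exp (- (of_real 1 * \<Lambda> (z ^ 1)))"
    if "0 \<le> x" "x < root 1 \<rho>" for x
    using ev_ball[OF that zero_less_one] by eventually_elim (simp add: W G_exp)
  \<comment> \<open>For U the factor is 2 / (\<open>\<beta>\<close> + 1), at least 4/3 since
    \<open>\<beta> \<le> 1/2\<close>.\<close>
  moreover have "1 \<le> real 2 * (1 / (\<beta> + 1))" using \<beta> by (simp add: field_simps)
  ultimately show ?thesis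
    using main[of 2 "1 / (\<beta> + 1)" "struve_U \<beta>"] main[of 2 1 "struve_V \<beta>"] main[of 1 1 "struve_W \<beta>"] fU
    by simp
qed

end
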